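(* Let $f_+,f_-:\mathbb R\to\mathbb R$ be of class $C^4$, let $u_1<u_0<u_2$ be real numbers and let $0\le\varepsilon_-<\varepsilon_0$. Assume that: (i) $D_+(u,\varepsilon)>0$ and $D_-(u,\varepsilon)>0$ for all $u\in[u_1,u_2]$ and all $\varepsilon\in(\varepsilon_-,\varepsilon_0)$; (ii) $\varepsilon_0$ is a simple root of the function $\varepsilon\mapsto D_-(u_0,\varepsilon)$, and $D_-(u,\varepsilon_0)>0$ for $u\in[u_1,u_2]\setminus\{u_0\}$; (iii) $D_+(u,\varepsilon_0)>0$ for all $u\in[u_1,u_2]$; (iv) $u_0$ is a root of the second order of the function $u\mapsto D_-(u,\varepsilon_0)$ (that is, the function and its first derivative vanish at $u_0$ and its second derivative does not). Then there exists $\varepsilon_+>\varepsilon_0$ such that for every $\varepsilon\in(\varepsilon_0,\varepsilon_+)$ there exist two roots $u^l<u^r$ in $(u_1,u_2)$ of the equation $D_-(u,\varepsilon)=0$, and one can construct the foliation $$\Omega^{\mathrm R}_\varepsilon(u_1,u^l)\cup\Omega^{\mathrm{E}-}_\varepsilon(u^l,u^r)\cup\Omega^{\mathrm R}_\varepsilon(u^r,u_2),$$ where the foliation of the domain $\Omega^{\mathrm{E}-}_\varepsilon(u^l,u^r)=\{(x_1,x_2): u^l\le x_1-x_2\le u^r,\ -\varepsilon\le x_2\le\varepsilon\}$ is a right horizontal herringbone whose spine extends from the point $(u^r-\varepsilon,-\varepsilon)$ to the point $(u^l-\varepsilon,-\varepsilon)$. That is, there is a $C^1$-smooth diagonally concave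 function $B$ on $\{u_1\le x_1-x_2\le u_2,\ |x_2|\le\varepsilon\}$ with $B(x_1,\pm\varepsilon)=f_\pm(x_1)$ whose restrictions to $\Omega^{\mathrm R}_\varepsilon(u_1,u^l)$ and $\Omega^{\mathrm R}_\varepsilon(u^r,u_2)$ are right simple candidates and whose restriction to $\Omega^{\mathrm{E}-}_\varepsilon(u^l,u^r)$ is a right herringbone candidate with a spine as described, which does not meet the line $x_2=0$.
   Context: Notation. For $x=(x_1,x_2)$ with $x_2\ne0$, the functions $D_\pm$ are defined by $$2x_2D_+(x)=f_+'(x_1+x_2)-f_-'(x_1-x_2)-2x_2f_+''(x_1+x_2),$$ $$2x_2D_-(x)=f_+'(x_1+x_2)-f_-'(x_1-x_2)-2x_2f_-''(x_1-x_2).$$ For $\varepsilon>0$ the strip is $\Omega_\varepsilon=\{(x_1,x_2):|x_2|\le\varepsilon\}$. A function on a subset of the strip is diagonally concave if it is concave on every segment contained in the subset and parallel to $(1,1)$ or to $(1,-1)$. Right simple candidate. $\Omega^{\mathrm R}_\varepsilon(a,b)=\{(x_1,x_2):a\le x_1-x_2\le b,\ |x_2|\le\varepsilon\}$, foliated by the segments $x_1-x_2=u$; the right simple candidate on it is the function, affine on each of these segments, $$B(x_1,x_2)=\frac{\varepsilon+x_2}{2\varepsilon}f_+(x_1-x_2+\varepsilon)+\frac{\varepsilon-x_2}{2\varepsilon}f_-(x_1-x_2-\varepsilon),$$ provided it is diagonally concave. Right (horizontal) herringbone. Its spine is a graph $\{(u,T(u)):u\in[p,q]\}$ with $T$ continuous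 on $[p,q]$, and $C^1$ with $|T|<\varepsilon$, $|T'|<1$ on $(p,q)$. From each spine point $(u,T)$, $T=T(u)$, two segments (ribs) go to the right: one to the upper boundary point $(u-T+\varepsilon,\varepsilon)$, the other to the lower boundary point $(u+T+\varepsilon,-\varepsilon)$. The domain is the union of all ribs. The shifted curve $\{(u+\varepsilon,T(u))\}$ is an integral curve of the field $$\dot x_1=\varepsilon(f_-'-f_+')-x_2(\varepsilon+x_2)f_+''-x_2(\varepsilon-x_2)f_-'',\qquad \dot x_2=x_2(f_-'-f_+')-x_2(\varepsilon+x_2)f_+''+x_2(\varepsilon-x_2)f_-'',$$ where the derivatives of $f_+$ are taken at $x_1-x_2$ and those of $f_-$ at $x_1+x_2$. A right herringbone candidate is a $C^1$-smooth diagonally concave function $B$ on this domain with $B(x_1,\pm\varepsilon)=f_\pm(x_1)$, affine on each rib, whose value at the spine point $(u,T)$ is $$\frac{\varepsilon^2-T^2}{2\varepsilon T}\big[(\varepsilon-T)f_-'-(\varepsilon+T)f_+'\big]+\frac{(\varepsilon+T)f_++(\varepsilon-T)f_-}{2\varepsilon},$$ with $f_+,f_+'$ taken at $u-T+\varepsilon$ and $f_-,f_-'$ taken at $u+T+\varepsilon$ (by continuity where $T=0$). *)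

theory Defs
  imports "HOL-Analysis.Analysis"
begin

definition class_C :: "nat \<Rightarrow> (real \<Rightarrow> real) \<Rightarrow> bool" where
  "class_C k f \<longleftrightarrow>
     (\<forall>j<k. \<forall>x. (deriv ^^ j) f differentiable (at x)) \<and> continuous_on UNIV ((deriv ^^ k) f)"

text \<open>
  Intended only for functions that are \<open>k\<close> times differentiable near \<open>x\<close>, since \<^const>\<open>deriv\<close> is
  unspecified at points of non-differentiability.
\<close>
definition root_of_order :: "nat \<Rightarrow> (real \<Rightarrow> real) \<Rightarrow> real \<Rightarrow> bool" where
  "root_of_order k g x \<longleftrightarrow> (\<forall>j<k. (deriv ^^ j) g x = 0) \<and> (deriv ^^ k) g x \<noteq> 0"

text \<open>
  The gradient has to extend continuously to the boundary points of \<open>S\<close>. For sets such as the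
  closed parallelograms used below this determines the derivative at every point.
\<close>
definition C1_smooth_on :: "(real \<times> real) set \<Rightarrow> (real \<times> real \<Rightarrow> real) \<Rightarrow> bool" where
  "C1_smooth_on S B \<longleftrightarrow>
     (\<exists>G. continuous_on S G \<and> (\<forall>x\<in>S. (B has_derivative (\<lambda>h. G x \<bullet> h)) (at x within S)))"

definition diagonally_concave_on :: "(real \<times> real) set \<Rightarrow> (real \<times> real \<Rightarrow> real) \<Rightarrow> bool" where
  "diagonally_concave_on S B \<longleftrightarrow>
     (\<forall>x y. closed_segment x y \<subseteq> S \<and> (\<exists>t. y - x = t *\<^sub>R (1, 1) \<or> y - x = t *\<^sub>R (1, -1))
        \<longrightarrow> concave_on (closed_segment x y) B)"

definition affine_on_segment ::
    "(real \<times> real \<Rightarrow> real) \<Rightarrow> real \<times> real \<Rightarrow> real \<times> real \<Rightarrow> bool" where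
  "affine_on_segment B x y \<longleftrightarrow>
     (\<forall>t\<in>{0..1}. B ((1 - t) *\<^sub>R x + t *\<^sub>R y) = (1 - t) * B x + t * B y)"

text \<open>Throughout, \<open>fp\<close> and \<open>fm\<close> are the data on the upper and on the lower boundary of the strip.\<close>

definition D_plus :: "(real \<Rightarrow> real) \<Rightarrow> (real \<Rightarrow> real) \<Rightarrow> real \<times> real \<Rightarrow> real" where
  "D_plus fp fm = (\<lambda>(x1, x2).
     (deriv fp (x1 + x2) - deriv fm (x1 - x2) - 2 * x2 * (deriv ^^ 2) fp (x1 + x2)) / (2 * x2))"

definition D_minus :: "(real \<Rightarrow> real) \<Rightarrow> (real \<Rightarrow> real) \<Rightarrow> real \<times> real \<Rightarrow> real" where
  "D_minus fp fm = (\<lambda>(x1, x2).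
     (deriv fp (x1 + x2) - deriv fm (x1 - x2) - 2 * x2 * (deriv ^^ 2) fm (x1 - x2)) / (2 * x2))"

definition strip :: "real \<Rightarrow> (real \<times> real) set" where
  "strip \<epsilon> = {(x1, x2). \<bar>x2\<bar> \<le> \<epsilon>}"

definition Omega_R :: "real \<Rightarrow> real \<Rightarrow> real \<Rightarrow> (real \<times> real) set" where
  "Omega_R \<epsilon> a b = {(x1, x2). (x1, x2) \<in> strip \<epsilon> \<and> a \<le> x1 - x2 \<and> x1 - x2 \<le> b}"

text \<open>
  As a set of points this coincides with \<^const>\<open>Omega_R\<close>; the two differ only in their foliations.
\<close>
definition Omega_E_minus :: "real \<Rightarrow> real \<Rightarrow> real \<Rightarrow> (real \<times> real) set" where
  "Omega_E_minus \<epsilon> a b = {(x1, x2). a \<le> x1 - x2 \<and> x1 - x2 \<le> b \<and> -\<epsilon> \<le> x2 \<and> x2 \<le> \<epsilon>}"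

definition boundary_values ::
    "(real \<Rightarrow> real) \<Rightarrow> (real \<Rightarrow> real) \<Rightarrow> real \<Rightarrow> (real \<times> real) set \<Rightarrow> (real \<times> real \<Rightarrow> real) \<Rightarrow> bool" where
  "boundary_values fp fm \<epsilon> S B \<longleftrightarrow>
     (\<forall>x1. ((x1, \<epsilon>) \<in> S \<longrightarrow> B (x1, \<epsilon>) = fp x1) \<and> ((x1, -\<epsilon>) \<in> S \<longrightarrow> B (x1, -\<epsilon>) = fm x1))"

definition right_simple_candidate ::
    "(real \<Rightarrow> real) \<Rightarrow> (real \<Rightarrow> real) \<Rightarrow> real \<Rightarrow> real \<Rightarrow> real \<Rightarrow> (real \<times> real \<Rightarrow> real) \<Rightarrow> bool" where
  "right_simple_candidate fp fm \<epsilon> a b B \<longleftrightarrow>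
     (\<forall>(x1, x2) \<in> Omega_R \<epsilon> a b.
        B (x1, x2) = (\<epsilon> + x2) / (2 * \<epsilon>) * fp (x1 - x2 + \<epsilon>)
                   + (\<epsilon> - x2) / (2 * \<epsilon>) * fm (x1 - x2 - \<epsilon>)) \<and>
     diagonally_concave_on (Omega_R \<epsilon> a b) B"

definition herringbone_field ::
    "(real \<Rightarrow> real) \<Rightarrow> (real \<Rightarrow> real) \<Rightarrow> real \<Rightarrow> real \<times> real \<Rightarrow> real \<times> real" where
  "herringbone_field fp fm \<epsilon> = (\<lambda>(x1, x2).
     let fp1 = deriv fp (x1 - x2); fp2 = (deriv ^^ 2) fp (x1 - x2);
         fm1 = deriv fm (x1 + x2); fm2 = (deriv ^^ 2) fm (x1 + x2)
     in (\<epsilon> * (fm1 - fp1) - x2 * (\<epsilon> + x2) * fp2 - x2 * (\<epsilon> - x2) * fm2,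
         x2 * (fm1 - fp1) - x2 * (\<epsilon> + x2) * fp2 + x2 * (\<epsilon> - x2) * fm2))"

text \<open>\<open>C\<close> is the trace of a solution of the autonomous system \<open>\<gamma>' = V \<gamma>\<close> on an open time interval.\<close>
definition integral_curve :: "(real \<times> real \<Rightarrow> real \<times> real) \<Rightarrow> (real \<times> real) set \<Rightarrow> bool" where
  "integral_curve V C \<longleftrightarrow>
     (\<exists>(\<gamma> :: real \<Rightarrow> real \<times> real) I. open I \<and> is_interval I \<and> I \<noteq> {} \<and>
        (\<forall>s\<in>I. (\<gamma> has_vector_derivative V (\<gamma> s)) (at s)) \<and> \<gamma> ` I = C)"

text \<open>
  The integral curve is the part of the shifted graph over the open interval: the field may vanish at
  an end point of the spine, which is then reached only in infinite time.
\<close>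
definition right_spine ::
    "(real \<Rightarrow> real) \<Rightarrow> (real \<Rightarrow> real) \<Rightarrow> real \<Rightarrow> real \<Rightarrow> real \<Rightarrow> (real \<Rightarrow> real) \<Rightarrow> bool" where
  "right_spine fp fm \<epsilon> p q T \<longleftrightarrow>
     p < q \<and> continuous_on {p..q} T \<and> T C1_differentiable_on {p<..<q} \<and>
     (\<forall>u\<in>{p<..<q}. \<bar>T u\<bar> < \<epsilon> \<and> \<bar>deriv T u\<bar> < 1) \<and>
     integral_curve (herringbone_field fp fm \<epsilon>) ((\<lambda>u. (u + \<epsilon>, T u)) ` {p<..<q})"

definition upper_rib_end :: "real \<Rightarrow> (real \<Rightarrow> real) \<Rightarrow> real \<Rightarrow> real \<times> real" where
  "upper_rib_end \<epsilon> T u = (u - T u + \<epsilon>, \<epsilon>)"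

definition lower_rib_end :: "real \<Rightarrow> (real \<Rightarrow> real) \<Rightarrow> real \<Rightarrow> real \<times> real" where
  "lower_rib_end \<epsilon> T u = (u + T u + \<epsilon>, -\<epsilon>)"

definition herringbone_domain :: "real \<Rightarrow> real \<Rightarrow> real \<Rightarrow> (real \<Rightarrow> real) \<Rightarrow> (real \<times> real) set" where
  "herringbone_domain \<epsilon> p q T =
     (\<Union>u\<in>{p..q}. closed_segment (u, T u) (upper_rib_end \<epsilon> T u)
               \<union> closed_segment (u, T u) (lower_rib_end \<epsilon> T u))"

definition spine_value :: "(real \<Rightarrow> real) \<Rightarrow> (real \<Rightarrow> real) \<Rightarrow> real \<Rightarrow> real \<Rightarrow> real \<Rightarrow> real" where
  "spine_value fp fm \<epsilon> u t =
     (\<epsilon>\<^sup>2 - t\<^sup>2) / (2 * \<epsilon> * t) *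
       ((\<epsilon> - t) * deriv fm (u + t + \<epsilon>) - (\<epsilon> + t) * deriv fp (u - t + \<epsilon>))
     + ((\<epsilon> + t) * fp (u - t + \<epsilon>) + (\<epsilon> - t) * fm (u + t + \<epsilon>)) / (2 * \<epsilon>)"

text \<open>Where \<open>T u = 0\<close> the value is the continuous extension of the formula in \<open>t\<close> to \<open>t = 0\<close>.\<close>
definition right_herringbone_candidate ::
    "(real \<Rightarrow> real) \<Rightarrow> (real \<Rightarrow> real) \<Rightarrow> real \<Rightarrow> real \<Rightarrow> real \<Rightarrow> (real \<Rightarrow> real)
       \<Rightarrow> (real \<times> real \<Rightarrow> real) \<Rightarrow> bool" where
  "right_herringbone_candidate fp fm \<epsilon> p q T B \<longleftrightarrow>
     right_spine fp fm \<epsilon> p q T \<and>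
     C1_smooth_on (herringbone_domain \<epsilon> p q T) B \<and>
     diagonally_concave_on (herringbone_domain \<epsilon> p q T) B \<and>
     boundary_values fp fm \<epsilon> (herringbone_domain \<epsilon> p q T) B \<and>
     (\<forall>u\<in>{p..q}.
        affine_on_segment B (u, T u) (upper_rib_end \<epsilon> T u) \<and>
        affine_on_segment B (u, T u) (lower_rib_end \<epsilon> T u) \<and>
        (if T u = 0 then ((spine_value fp fm \<epsilon> u) \<longlongrightarrow> B (u, 0)) (at 0)
         else B (u, T u) = spine_value fp fm \<epsilon> u (T u)))"

end

theory Submission
  imports Defs "HOL-Complex_Analysis.Great_Picard"
begin

text \<open>
  A spine is followed here through its mirror image \<open>t = -T\<close>, as a function of \<open>c = u + \<epsilon>\<close>. The two ribs
  that leave the spine point \<open>(c - \<epsilon>, -t)\<close> end at the boundary abscissae \<open>a = c + t\<close> (above) and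
  \<open>b = c - t\<close> (below), and up to a common factor the herringbone field says
  \<open>a' = (\<epsilon> + t) D\<^sub>-(c, t)\<close> and \<open>b' = (\<epsilon> - t) D\<^sub>+(c, t)\<close>. So the spine has slope less than one in absolute
  value exactly when \<open>a\<close> and \<open>b\<close> move in the same direction, and positivity of \<open>D\<^sub>+\<close> and \<open>D\<^sub>-\<close> along the
  spine is sufficient.

  \<^bold>\<open>The function over a given spine.\<close> Extend \<open>t\<close> by the value \<open>\<epsilon>\<close> outside the interval \<open>(u\<^sup>l, u\<^sup>r)\<close>; the ribs
  then degenerate to the segments of the simple foliation, and all three domains are treated at once.
  Put \<open>N(c) = (f\<^sub>+'(a) - f\<^sub>-'(b)) / (2t)\<close>, so that \<open>D\<^sub>+ = N - f\<^sub>+''(a)\<close> and \<open>D\<^sub>- = N - f\<^sub>-''(b)\<close>. The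
  slope of the function along the upper rib, as a function of \<open>a\<close>, has derivative \<open>N\<close>; the slope along
  the lower rib, as a function of \<open>b\<close>, has derivative \<open>-N\<close>. This makes both pieces \<open>C\<^sup>1\<close> and their
  gradients equal on the spine. Along the spine \<open>N\<close> has derivative \<open>-D\<^sub>+ D\<^sub>-\<close> in the time of the rescaled
  field, and the second derivative of the function across the herringbone ribs becomes \<open>D\<^sub>+\<close> or \<open>D\<^sub>-\<close> times a factor
  that is nonpositive on the relevant side of the spine; this gives diagonal concavity
  (\<open>\<Phi>_antimono\<close>, \<open>\<Psi>_antimono\<close>). The outcome is \<open>candidate_exists\<close>.

  \<^bold>\<open>Existence of the spine.\<close> The points \<open>(u\<^sup>l, \<epsilon>)\<close> and \<open>(u\<^sup>r, \<epsilon>)\<close> are equilibria of the rescaled field, a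
  saddle and a stable node born from the saddle-node at \<open>(u\<^sub>0, \<epsilon>\<^sub>0)\<close>, and the spine is an orbit connecting
  them. It is found between two barriers: with \<open>s = \<epsilon> - t\<close> the orbit solves a scalar equation
  \<open>ds/dc = F(c, s)\<close>, and near the saddle-node the slow manifold is \<open>s = 2Q/\<lambda>\<close> to leading order, where
  \<open>Q(c) = -2\<epsilon> D\<^sub>-(c, \<epsilon>)\<close> is positive exactly between the two roots and \<open>\<lambda> = 2 D\<^sub>+(u\<^sub>0, \<epsilon>\<^sub>0)\<close>. The curves
  \<open>s = \<kappa>Q/\<lambda>\<close> with \<open>\<kappa> = 4/3\<close> and \<open>\<kappa> = 4\<close> are a strict lower and a strict upper barrier, because \<open>F\<close> is bounded
  away from zero on them, with opposite signs, while they are themselves almost horizontal. Both vanish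
  at the end points, so any solution between them (\<open>ode_between_barriers\<close>) starts and ends at the
  equilibria; for \<open>s\<close> beyond the lower barrier \<open>D\<^sub>-\<close> is positive, as the construction of the function requires.
\<close>

section \<open>One-variable calculus\<close>

lemma class_C_has_deriv:
  assumes "class_C k f" and "j < k"
  shows "((deriv ^^ j) f has_real_derivative (deriv ^^ Suc j) f x) (at x)"
  using assms by (auto simp: class_C_def real_differentiableE DERIV_deriv_iff_real_differentiable)

lemma class_C_continuous_deriv:
  assumes "class_C k f" and "j \<le> k"
  shows "continuous_on UNIV ((deriv ^^ j) f)"
proof (cases "j = k")
  case True
  then show ?thesis using assms by (simp add: class_C_def)
next
  case False
  then show ?thesis
    using assms class_C_has_deriv[OF assms(1), of j]
    by (intro continuous_at_imp_continuous_on) (auto intro: DERIV_isCont)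
qed

lemma class_C_mono:
  assumes "class_C k f" and "j \<le> k"
  shows "class_C j f"
  using assms class_C_continuous_deriv[OF assms] by (auto simp: class_C_def)

text \<open>
  The parametrizations below need not be differentiable at the two end points of the spine, so the
  usual monotonicity criteria are needed with finitely many exceptional points.
\<close>
lemma has_real_derivative_pos_off_finite_imp_less:
  fixes f :: "real \<Rightarrow> real"
  assumes "finite S" and "x < y" and "continuous_on {x..y} f"
    and "\<And>c. \<lbrakk>x < c; c < y; c \<notin> S\<rbrakk> \<Longrightarrow> \<exists>d. (f has_real_derivative d) (at c) \<and> 0 < d"
  shows "f x < f y"
  using assms
proof (induction S arbitrary: x y rule: finite_induct)
  case empty
  then show ?case using DERIV_pos_imp_increasing_open[of x y f] by simp
next
  case (insert s S)
  show ?case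
  proof (cases "x < s \<and> s < y")
    case True
    have "f x < f s"
      by (rule insert.IH) (use True insert.prems in \<open>auto intro: continuous_on_subset\<close>)
    also have "f s < f y"
      by (rule insert.IH) (use True insert.prems in \<open>auto intro: continuous_on_subset\<close>)
    finally show ?thesis .
  next
    case False
    then show ?thesis
      using insert.prems by (intro insert.IH) auto
  qed
qed

lemma has_real_derivative_nonpos_off_finite_imp_ge:
  fixes f :: "real \<Rightarrow> real"
  assumes "finite S" and "x \<le> y" and "continuous_on {x..y} f"
    and "\<And>c. \<lbrakk>x < c; c < y; c \<notin> S\<rbrakk> \<Longrightarrow> \<exists>d. (f has_real_derivative d) (at c) \<and> d \<le> 0"
  shows "f y \<le> f x"
  using assms
proof (induction S arbitrary: x y rule: finite_induct)
  case empty
  then show ?case using DERIV_nonpos_imp_decreasing_open[of x y f] by simp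
next
  case (insert s S)
  show ?case
  proof (cases "x < s \<and> s < y")
    case True
    have "f s \<le> f x"
      by (rule insert.IH) (use True insert.prems in \<open>auto intro: continuous_on_subset\<close>)
    moreover have "f y \<le> f s"
      by (rule insert.IH) (use True insert.prems in \<open>auto intro: continuous_on_subset\<close>)
    ultimately show ?thesis by simp
  next
    case False
    then show ?thesis
      using insert.prems by (intro insert.IH) auto
  qed
qed

lemma has_real_derivative_zero_off_finite_imp_eq:
  fixes f :: "real \<Rightarrow> real"
  assumes "finite S" and "x \<le> y" and "continuous_on {x..y} f"
    and "\<And>c. \<lbrakk>x < c; c < y; c \<notin> S\<rbrakk> \<Longrightarrow> (f has_real_derivative 0) (at c)"
  shows "f y = f x"
proof (rule antisym)
  show "f y \<le> f x"
    by (rule has_real_derivative_nonpos_off_finite_imp_ge[OF assms(1-3)]) (use assms(4) in blast)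
  have "- f y \<le> - f x"
    by (rule has_real_derivative_nonpos_off_finite_imp_ge[OF assms(1,2), of "\<lambda>x. - f x"])
       (use assms(3,4) DERIV_minus in \<open>force intro: continuous_intros\<close>)+
  then show "f x \<le> f y" by simp
qed

lemma antiderivative_exists:
  fixes f :: "real \<Rightarrow> real"
  assumes "continuous_on UNIV f"
  shows "\<exists>F. (\<forall>x. (F has_real_derivative f x) (at x)) \<and> F x0 = y0"
proof -
  have "isCont f x" for x using assms by (simp add: continuous_on_eq_continuous_at)
  then obtain F where "\<And>x. (F has_vector_derivative f x) (at x)"
    using einterval_antiderivative[of "-\<infinity>" \<infinity> f] by auto
  then have "\<forall>x. ((\<lambda>x. F x + (y0 - F x0)) has_real_derivative f x) (at x)"
    by (auto simp: has_real_derivative_iff_has_vector_derivative[symmetric] intro!: derivative_eq_intros)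
  then show ?thesis by (intro exI[of _ "\<lambda>x. F x + (y0 - F x0)"]) simp
qed

lemma pos_on_compact_nearby:
  fixes F :: "real \<Rightarrow> real \<Rightarrow> real"
  assumes "continuous_on UNIV (\<lambda>z. F (fst z) (snd z))" and "compact K" and "\<And>c. c \<in> K \<Longrightarrow> 0 < F c t0"
  shows "\<exists>\<rho>>0. \<forall>c\<in>K. \<forall>t. \<bar>t - t0\<bar> < \<rho> \<longrightarrow> 0 < F c t"
proof -
  have "open {z. 0 < F (fst z) (snd z)}"
    by (rule open_Collect_less[OF continuous_on_const assms(1)])
  moreover have "compact (K \<times> {t0})" using assms(2) by (intro compact_Times) auto
  moreover have "K \<times> {t0} \<subseteq> {z. 0 < F (fst z) (snd z)}" using assms(3) by auto
  ultimately obtain e where e: "0 < e" "(\<Union>x\<in>K \<times> {t0}. ball x e) \<subseteq> {z. 0 < F (fst z) (snd z)}"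
    using compact_subset_open_imp_ball_epsilon_subset[of "K \<times> {t0}" "{z. 0 < F (fst z) (snd z)}"]
    by auto
  show ?thesis
  proof (intro exI[of _ e] conjI ballI allI impI)
    fix c t assume "c \<in> K" "\<bar>t - t0\<bar> < e"
    then have "(c, t) \<in> ball (c, t0) e" by (simp add: dist_Pair_Pair dist_real_def abs_minus_commute)
    then show "0 < F c t" using e \<open>c \<in> K\<close> by force
  qed (rule e)
qed

text \<open>
  The sign pattern of a convex function that is negative somewhere: it can leave the negative values
  only once on either side.
\<close>
lemma convex_on_neg_between:
  fixes f :: "real \<Rightarrow> real"
  assumes "convex_on I f" "x \<in> I" "y \<in> I" "f x \<le> 0" "f y < 0" and z: "x < z \<and> z \<le> y \<or> y \<le> z \<and> z < x"
  shows "f z < 0"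
proof -
  define \<theta> where "\<theta> = (z - x) / (y - x)"
  have \<theta>: "0 < \<theta>" "\<theta> \<le> 1" and ne: "y - x \<noteq> 0"
    using z by (auto simp: \<theta>_def field_simps)
  have "\<theta> * (y - x) = z - x" using ne by (simp add: \<theta>_def)
  then have "z = (1 - \<theta>) *\<^sub>R x + \<theta> *\<^sub>R y"
    by (simp add: algebra_simps)
  then have "f z \<le> (1 - \<theta>) * f x + \<theta> * f y"
    using convex_onD[OF assms(1), of \<theta> x y] \<theta> assms by simp
  also have "\<dots> < 0"
    using \<theta> assms(4,5) by (intro add_nonpos_neg mult_nonneg_nonpos mult_pos_neg) auto
  finally show ?thesis .
qed

text \<open>
  The slope of the spine has the form \<open>(x - y) / (x + y)\<close>; it is controlled through the ratio of
  \<open>x\<close> and \<open>y\<close>.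
\<close>
lemma ratio_bounds:
  fixes x y :: real
  assumes "0 < x" "0 < y"
  shows "51 * y \<le> 49 * x \<Longrightarrow> 1/50 \<le> (x - y) / (x + y)" "26 * x \<le> 24 * y \<Longrightarrow> (x - y) / (x + y) \<le> - 1/25"
    "\<bar>(x - y) / (x + y)\<bar> \<le> 1"
  using assms by (auto simp: field_simps abs_le_iff)

section \<open>A scalar differential equation between two barriers\<close>

lemma integrable_bounded_continuous_interior:
  fixes f :: "real \<Rightarrow> real"
  assumes "continuous_on {l<..<r} f" and "\<And>x. \<bar>f x\<bar> \<le> M"
  shows "f integrable_on {l..r}"
proof -
  have "f \<in> borel_measurable (lebesgue_on {l<..<r})"
    by (rule continuous_imp_measurable_on_sets_lebesgue[OF assms(1)]) auto
  moreover have "(\<lambda>x. M) integrable_on {l<..<r}"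
    using integrable_const_ivl[of M l r] by (simp only: integrable_on_open_interval_real)
  ultimately have "f integrable_on {l<..<r}"
    by (rule measurable_bounded_by_integrable_imp_integrable) (use assms(2) in auto)
  then show ?thesis
    unfolding integrable_on_open_interval_real .
qed

lemma indefinite_integral_lipschitz:
  fixes f :: "real \<Rightarrow> real"
  assumes "f integrable_on {l..r}" and "\<And>x. \<bar>f x\<bar> \<le> 1" and "l \<le> r"
  shows "\<bar>integral {l..min x r} f - integral {l..min y r} f\<bar> \<le> \<bar>x - y\<bar>"
proof (induction x y rule: linorder_wlog)
  case (sym x y)
  then show ?case by (simp add: abs_minus_commute)
next
  case (le x y)
  define p q where "p = max l (min x r)" and "q = max l (min y r)"
  have p: "integral {l..min x r} f = integral {l..p} f"
    by (cases "min x r < l") (auto simp: p_def max_def)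
  have q: "integral {l..min y r} f = integral {l..q} f"
    by (cases "min y r < l") (auto simp: q_def max_def)
  have lpq: "l \<le> p" "p \<le> q" "q \<le> r"
    using le assms(3) by (auto simp: p_def q_def)
  have "integral {l..p} f + integral {p..q} f = integral {l..q} f"
    by (rule Henstock_Kurzweil_Integration.integral_combine)
       (use lpq integrable_on_subinterval[OF assms(1), of l q] in auto)
  moreover have "norm (integral {p..q} f) \<le> 1 * (q - p)"
    using has_integral_bound[of 1 f "integral {p..q} f" p q] lpq assms(2)
      integrable_integral[OF integrable_on_subinterval[OF assms(1), of p q]] by simp
  moreover have "q - p \<le> \<bar>x - y\<bar>"
    using le by (auto simp: p_def q_def)
  ultimately show ?case
    unfolding p q by simp
qed

text \<open>
  Tonelli's approximation: with the unknown delayed by \<open>h\<close>, the integral equation determines the solution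
  on \<open>[l, l + n h]\<close> after \<open>n\<close> steps, so iterating the integral operator becomes stationary.
\<close>
lemma tonelli_delay_solution:
  fixes F :: "real \<Rightarrow> real \<Rightarrow> real"
  assumes "l \<le> r" and "0 < h"
    and cont: "continuous_on ({l<..<r} \<times> UNIV) (\<lambda>(x, y). F x y)"
    and bound: "\<And>x y. \<bar>F x y\<bar> \<le> 1"
  obtains s where "\<And>x y. \<bar>s x - s y\<bar> \<le> \<bar>x - y\<bar>"
    and "\<And>x. x \<le> r \<Longrightarrow> s x = v + integral {l..x} (\<lambda>y. F y (s (y - h)))"
    and "\<And>x. x \<le> r \<Longrightarrow> (\<lambda>y. F y (s (y - h))) integrable_on {l..x}"
proof -
  define \<phi> :: "nat \<Rightarrow> real \<Rightarrow> real" where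
    "\<phi> = rec_nat (\<lambda>_. v) (\<lambda>_ p x. v + integral {l..min x r} (\<lambda>y. F y (p (y - h))))"
  have \<phi>0: "\<phi> 0 x = v" for x by (simp add: \<phi>_def)
  have \<phi>Suc: "\<phi> (Suc n) x = v + integral {l..min x r} (\<lambda>y. F y (\<phi> n (y - h)))" for n x
    by (simp add: \<phi>_def)
  have integ: "(\<lambda>y. F y (p (y - h))) integrable_on {l..r}"
    if "\<And>x y. \<bar>p x - p y\<bar> \<le> \<bar>x - y\<bar>" for p :: "real \<Rightarrow> real"
  proof (rule integrable_bounded_continuous_interior[OF _ bound])
    have "continuous_on UNIV p"
      by (rule lipschitz_on_continuous_on[of 1], rule lipschitz_onI) (use that in \<open>auto simp: dist_real_def\<close>)
    then have "continuous_on {l<..<r} (\<lambda>y. p (y - h))"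
      by (rule continuous_on_compose2) (auto intro!: continuous_intros)
    then have "continuous_on {l<..<r} (\<lambda>y. (y, p (y - h)))"
      by (intro continuous_intros)
    from continuous_on_compose2[OF cont this] show "continuous_on {l<..<r} (\<lambda>y. F y (p (y - h)))"
      by auto
  qed
  have lip: "\<bar>\<phi> n x - \<phi> n y\<bar> \<le> \<bar>x - y\<bar>" for n x y
  proof (induction n arbitrary: x y)
    case (Suc n)
    show ?case
      using indefinite_integral_lipschitz[OF integ bound assms(1), of "\<phi> n" x y] Suc.IH
      by (simp add: \<phi>Suc)
  qed (simp add: \<phi>0)
  have stable: "\<phi> (Suc n) x = \<phi> n x" if "x \<le> l + real n * h" for n x
    using that
  proof (induction n arbitrary: x)
    case 0
    then have "integral {l..min x r} (\<lambda>y. F y (\<phi> 0 (y - h))) = 0"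
      by (cases "min x r < l") (auto simp: min_def max_def)
    then show ?case unfolding \<phi>Suc by (simp add: \<phi>0)
  next
    case (Suc n)
    have "integral {l..min x r} (\<lambda>y. F y (\<phi> (Suc n) (y - h)))
        = integral {l..min x r} (\<lambda>y. F y (\<phi> n (y - h)))"
      by (rule integral_cong) (use Suc in \<open>auto simp: algebra_simps\<close>)
    then show ?case by (simp only: \<phi>Suc)
  qed
  obtain n :: nat where "r - l < real n * h"
    using assms(2) reals_Archimedean3 by blast
  then have "\<phi> n x = v + integral {l..x} (\<lambda>y. F y (\<phi> n (y - h)))" if "x \<le> r" for x
    using stable[of x n] that by (simp add: \<phi>Suc min_absorb1)
  moreover have "(\<lambda>y. F y (\<phi> n (y - h))) integrable_on {l..x}" if "x \<le> r" for x
    using integrable_on_subinterval[OF integ[of "\<phi> n"], of l x] lip that by auto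
  ultimately show ?thesis using that lip by blast
qed

text \<open>
  Peano's theorem for a right-hand side that is merely bounded near the end points of the interval. The
  delayed solutions are uniformly Lipschitz, so a subsequence converges uniformly, and dominated
  convergence passes to the limit in the integral equation although continuity fails at the end points.
\<close>
lemma peano_existence_singular_endpoints:
  fixes F :: "real \<Rightarrow> real \<Rightarrow> real"
  assumes "l < r"
    and cont: "continuous_on ({l<..<r} \<times> UNIV) (\<lambda>(x, y). F x y)"
    and bound: "\<And>x y. \<bar>F x y\<bar> \<le> 1"
  obtains s where "continuous_on {l..r} s" and "s l = v"
    and "\<And>x. x \<in> {l<..<r} \<Longrightarrow> (s has_real_derivative F x (s x)) (at x)"
proof -
  have "\<exists>s. (\<forall>x y. \<bar>s x - s y\<bar> \<le> \<bar>x - y\<bar>) \<and>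
      (\<forall>x\<le>r. s x = v + integral {l..x} (\<lambda>y. F y (s (y - h))) \<and>
              (\<lambda>y. F y (s (y - h))) integrable_on {l..x})" if "0 < h" for h :: real
  proof -
    from tonelli_delay_solution[OF less_imp_le[OF \<open>l < r\<close>] that cont bound, of v] obtain s
      where "\<And>x y. \<bar>s x - s y\<bar> \<le> \<bar>x - y\<bar>"
        "\<And>x. x \<le> r \<Longrightarrow> s x = v + integral {l..x} (\<lambda>y. F y (s (y - h)))"
        "\<And>x. x \<le> r \<Longrightarrow> (\<lambda>y. F y (s (y - h))) integrable_on {l..x}" by blast
    then show ?thesis by blast
  qed
  from this[of "1 / real (Suc n)" for n] have "\<forall>n. \<exists>s. (\<forall>x y. \<bar>s x - s y\<bar> \<le> \<bar>x - y\<bar>) \<and>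
      (\<forall>x\<le>r. s x = v + integral {l..x} (\<lambda>y. F y (s (y - 1 / real (Suc n)))) \<and>
              (\<lambda>y. F y (s (y - 1 / real (Suc n)))) integrable_on {l..x})"
    by simp
  then obtain \<sigma> where lip: "\<And>n x y. \<bar>\<sigma> n x - \<sigma> n y\<bar> \<le> \<bar>x - y\<bar>"
    and eq: "\<And>n x. x \<le> r \<Longrightarrow>
          \<sigma> n x = v + integral {l..x} (\<lambda>y. F y (\<sigma> n (y - 1 / real (Suc n))))"
    and int: "\<And>n x. x \<le> r \<Longrightarrow> (\<lambda>y. F y (\<sigma> n (y - 1 / real (Suc n)))) integrable_on {l..x}"
    unfolding choice_iff by blast
  have \<sigma>l: "\<sigma> n l = v" for n
    using eq[of l n] \<open>l < r\<close> by simp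
  have "norm (\<sigma> n x) \<le> \<bar>v\<bar> + (r - l)" if "x \<in> {l..r}" for n x
    using lip[of n x l] that unfolding \<sigma>l by auto
  moreover have "\<exists>d>0. \<forall>n y. y \<in> {l..r} \<and> norm (x - y) < d \<longrightarrow> norm (\<sigma> n x - \<sigma> n y) < e"
    if "0 < e" for x e
    using le_less_trans[OF lip] that by (intro exI[of _ e]) simp
  ultimately obtain s k where s: "continuous_on {l..r} s" and k: "strict_mono (k :: nat \<Rightarrow> nat)"
    and unif: "\<And>e. 0 < e \<Longrightarrow> \<exists>N. \<forall>n x. n \<ge> N \<and> x \<in> {l..r} \<longrightarrow> norm (\<sigma> (k n) x - s x) < e"
    using Arzela_Ascoli[of "{l..r}" \<sigma> "\<bar>v\<bar> + (r - l)"] by (metis compact_Icc)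
  have lim: "(\<lambda>n. \<sigma> (k n) x) \<longlonglongrightarrow> s x" if "x \<in> {l..r}" for x
    using unif that unfolding lim_sequentially dist_norm by blast
  have "(\<lambda>n. 1 / real (Suc (k n))) \<longlonglongrightarrow> 0"
    using LIMSEQ_subseq_LIMSEQ[OF LIMSEQ_Suc[OF lim_1_over_n] k] by (simp add: o_def)
  have limd: "(\<lambda>n. \<sigma> (k n) (x - 1 / real (Suc (k n)))) \<longlonglongrightarrow> s x" if "x \<in> {l..r}" for x
  proof -
    have "(\<lambda>n. \<sigma> (k n) (x - 1 / real (Suc (k n))) - \<sigma> (k n) x) \<longlonglongrightarrow> 0"
      by (rule Lim_null_comparison[OF always_eventually \<open>(\<lambda>n. 1 / real (Suc (k n))) \<longlonglongrightarrow> 0\<close>])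
         (use order_trans[OF lip] in simp)
    from tendsto_add[OF this lim[OF that]] show ?thesis by simp
  qed
  have limF: "(\<lambda>n. F x (\<sigma> (k n) (x - 1 / real (Suc (k n))))) \<longlonglongrightarrow> F x (s x)"
    if "x \<in> {l<..<r}" for x
  proof -
    have "(\<lambda>n. (x, \<sigma> (k n) (x - 1 / real (Suc (k n))))) \<longlonglongrightarrow> (x, s x)"
      using limd that by (intro tendsto_intros) auto
    from continuous_on_tendsto_compose[OF cont this] show ?thesis using that by auto
  qed
  have contF: "continuous_on {l<..<r} (\<lambda>y. F y (s y))"
  proof -
    have "continuous_on {l<..<r} (\<lambda>y. (y, s y))"
      by (intro continuous_intros continuous_on_subset[OF s]) auto
    from continuous_on_compose2[OF cont this] show ?thesis
      by auto
  qed
  have sint: "(\<lambda>y. F y (s y)) integrable_on {l..r}"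
    by (rule integrable_bounded_continuous_interior[OF contF bound])
  have seq: "s x = v + integral {l..x} (\<lambda>y. F y (s y))" if x: "x \<in> {l..r}" for x
  proof -
    have "(\<lambda>n. integral {l<..<x} (\<lambda>y. F y (\<sigma> (k n) (y - 1 / real (Suc (k n))))))
        \<longlonglongrightarrow> integral {l<..<x} (\<lambda>y. F y (s y))"
      by (rule dominated_convergence(2)[where h = "\<lambda>_. 1"])
         (use x int bound limF in \<open>auto simp: integrable_on_open_interval_real\<close>)
    then have "(\<lambda>n. v + integral {l..x} (\<lambda>y. F y (\<sigma> (k n) (y - 1 / real (Suc (k n))))))
        \<longlonglongrightarrow> v + integral {l..x} (\<lambda>y. F y (s y))"
      unfolding integral_open_interval_real[symmetric] by (intro tendsto_intros)
    then have "(\<lambda>n. \<sigma> (k n) x) \<longlonglongrightarrow> v + integral {l..x} (\<lambda>y. F y (s y))"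
      using eq[of x] x by simp
    with lim[OF x] show ?thesis by (rule LIMSEQ_unique)
  qed
  show ?thesis
  proof (rule that[OF s])
    show "s l = v" using seq[of l] \<open>l < r\<close> by simp
    fix x assume x: "x \<in> {l<..<r}"
    have "isCont (\<lambda>y. F y (s y)) x"
      using contF x by (simp add: continuous_on_eq_continuous_at)
    then have "((\<lambda>u. integral {l..u} (\<lambda>y. F y (s y))) has_vector_derivative F x (s x)) (at x within {l..r})"
      using integral_has_vector_derivative_continuous_at[OF sint, of x "{}"] x
      by (auto intro: continuous_at_imp_continuous_at_within)
    then have "((\<lambda>u. integral {l..u} (\<lambda>y. F y (s y))) has_real_derivative F x (s x)) (at x)"
      using x by (simp add: has_real_derivative_iff_has_vector_derivative at_within_Icc_at)
    then have "((\<lambda>u. v + integral {l..u} (\<lambda>y. F y (s y))) has_real_derivative F x (s x)) (at x)"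
      by (auto intro!: derivative_eq_intros)
    then show "(s has_real_derivative F x (s x)) (at x)"
      by (rule has_field_derivative_transform_within_open[where S = "{l<..<r}"]) (use x seq in auto)
  qed
qed

text \<open>
  Cutting the second argument off at the barriers gives a right-hand side defined everywhere. A solution
  of the modified equation cannot cross a barrier: beyond it, the slope is the one on the barrier and
  points back. The barriers may touch at the end points, where the equation can be singular; the spine
  starts and ends at equilibria, where the quotient defining its slope is \<open>0/0\<close>.
\<close>
lemma ode_between_barriers:
  fixes F :: "real \<Rightarrow> real \<Rightarrow> real" and \<alpha> \<beta> \<alpha>' \<beta>' :: "real \<Rightarrow> real"
  assumes "l < r"
    and cont: "continuous_on {(x, y). l < x \<and> x < r \<and> \<alpha> x \<le> y \<and> y \<le> \<beta> x} (\<lambda>(x, y). F x y)"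
    and bound: "\<And>x y. \<lbrakk>l < x; x < r; \<alpha> x \<le> y; y \<le> \<beta> x\<rbrakk> \<Longrightarrow> \<bar>F x y\<bar> \<le> 1"
    and c\<alpha>: "continuous_on {l..r} \<alpha>" and c\<beta>: "continuous_on {l..r} \<beta>"
    and le: "\<And>x. \<lbrakk>l \<le> x; x \<le> r\<rbrakk> \<Longrightarrow> \<alpha> x \<le> \<beta> x"
    and v: "\<alpha> l \<le> v" "v \<le> \<beta> l"
    and d\<alpha>: "\<And>x. \<lbrakk>l < x; x < r\<rbrakk> \<Longrightarrow> (\<alpha> has_real_derivative \<alpha>' x) (at x)"
    and d\<beta>: "\<And>x. \<lbrakk>l < x; x < r\<rbrakk> \<Longrightarrow> (\<beta> has_real_derivative \<beta>' x) (at x)"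
    and sub: "\<And>x. \<lbrakk>l < x; x < r\<rbrakk> \<Longrightarrow> \<alpha>' x \<le> F x (\<alpha> x)"
    and super: "\<And>x. \<lbrakk>l < x; x < r\<rbrakk> \<Longrightarrow> F x (\<beta> x) \<le> \<beta>' x"
  obtains s where "continuous_on {l..r} s" and "s l = v"
    and "\<And>x. x \<in> {l..r} \<Longrightarrow> \<alpha> x \<le> s x \<and> s x \<le> \<beta> x"
    and "\<And>x. x \<in> {l<..<r} \<Longrightarrow> (s has_real_derivative F x (s x)) (at x)"
proof -
  define cut where "cut x y = max (\<alpha> x) (min y (\<beta> x))" for x y
  define H where "H x y = (if l < x \<and> x < r then F x (cut x y) else 0)" for x y
  have cut: "\<alpha> x \<le> cut x y \<and> cut x y \<le> \<beta> x" if "l < x" "x < r" for x y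
    using le[of x] that by (auto simp: cut_def)
  have "continuous_on ({l<..<r} \<times> UNIV) (\<lambda>z. \<alpha> (fst z))"
    by (rule continuous_on_compose2[OF c\<alpha> continuous_on_fst[OF continuous_on_id]]) auto
  moreover have "continuous_on ({l<..<r} \<times> UNIV) (\<lambda>z. \<beta> (fst z))"
    by (rule continuous_on_compose2[OF c\<beta> continuous_on_fst[OF continuous_on_id]]) auto
  ultimately have "continuous_on ({l<..<r} \<times> UNIV) (\<lambda>z. (fst z, cut (fst z) (snd z)))"
    unfolding cut_def by (intro continuous_intros)
  then have "continuous_on ({l<..<r} \<times> UNIV) (\<lambda>z. case (fst z, cut (fst z) (snd z)) of (x, y) \<Rightarrow> F x y)"
    by (rule continuous_on_compose2[OF cont]) (use cut in auto)
  then have contH: "continuous_on ({l<..<r} \<times> UNIV) (\<lambda>(x, y). H x y)"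
    by (rule continuous_on_eq) (auto simp: H_def)
  have "\<bar>H x y\<bar> \<le> 1" for x y
    using bound cut by (simp add: H_def)
  from peano_existence_singular_endpoints[OF \<open>l < r\<close> contH this, of v]
  obtain s where s: "continuous_on {l..r} s" "s l = v"
    and ds: "\<And>x. x \<in> {l<..<r} \<Longrightarrow> (s has_real_derivative H x (s x)) (at x)" by metis
  \<comment> \<open>A function that increases wherever it is negative stays nonnegative: look at the last nonnegative point.\<close>
  have barrier: "0 \<le> w b"
    if w: "continuous_on {l..r} w" "0 \<le> w l" and b: "b \<in> {l..r}"
      and dw: "\<And>x. \<lbrakk>l < x; x < r; w x < 0\<rbrakk> \<Longrightarrow> \<exists>y. DERIV w x :> y \<and> y \<ge> 0"
    for w :: "real \<Rightarrow> real" and b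
  proof (rule ccontr)
    assume "\<not> 0 \<le> w b"
    define S where "S = {l..b} \<inter> w -` {0..}"
    have "closed S" unfolding S_def
      by (rule continuous_closed_preimage) (use b continuous_on_subset[OF w(1)] in auto)
    moreover have "l \<in> S" using w b by (auto simp: S_def)
    moreover have bdd: "bdd_above S" by (rule bdd_aboveI[of _ b]) (auto simp: S_def)
    ultimately have "Sup S \<in> S" by (metis closed_contains_Sup empty_iff)
    define a where "a = Sup S"
    have a: "l \<le> a" "a \<le> b" "0 \<le> w a" using \<open>Sup S \<in> S\<close> by (auto simp: S_def a_def)
    have "w x < 0" if "a < x" "x \<le> b" for x
    proof (rule ccontr)
      assume "\<not> w x < 0"
      then have "x \<in> S" using that a by (auto simp: S_def)
      then show False using cSup_upper[OF _ bdd, of x] that unfolding a_def by auto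
    qed
    then have "\<exists>y. DERIV w x :> y \<and> y \<ge> 0" if "a < x" "x < b" for x
      using that a b by (intro dw) simp_all
    moreover have "continuous_on {a..b} w"
      by (rule continuous_on_subset[OF w(1)]) (use a b in simp)
    ultimately have "w a \<le> w b"
      by (rule DERIV_nonneg_imp_increasing_open[OF a(2)])
    with a \<open>\<not> 0 \<le> w b\<close> show False by simp
  qed
  have lo: "0 \<le> s x - \<alpha> x" if "x \<in> {l..r}" for x
  proof (rule barrier[of "\<lambda>x. s x - \<alpha> x"])
    fix x assume x: "l < x" "x < r" "s x - \<alpha> x < 0"
    then have "H x (s x) = F x (\<alpha> x)"
      using le[of x] by (simp add: H_def cut_def max_def min_def)
    then show "\<exists>y. ((\<lambda>x. s x - \<alpha> x) has_real_derivative y) (at x) \<and> 0 \<le> y"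
      using DERIV_diff[OF ds[of x] d\<alpha>[of x]] sub[of x] x by force
  qed (use s c\<alpha> v that in \<open>auto intro!: continuous_intros\<close>)
  have hi: "0 \<le> \<beta> x - s x" if "x \<in> {l..r}" for x
  proof (rule barrier[of "\<lambda>x. \<beta> x - s x"])
    fix x assume x: "l < x" "x < r" "\<beta> x - s x < 0"
    then have "H x (s x) = F x (\<beta> x)"
      using le[of x] by (simp add: H_def cut_def max_def min_def)
    then show "\<exists>y. ((\<lambda>x. \<beta> x - s x) has_real_derivative y) (at x) \<and> 0 \<le> y"
      using DERIV_diff[OF d\<beta>[of x] ds[of x]] super[of x] x by force
  qed (use s c\<beta> v that in \<open>auto intro!: continuous_intros\<close>)
  have "H x (s x) = F x (s x)" if "x \<in> {l<..<r}" for x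
    using lo[of x] hi[of x] that by (simp add: H_def cut_def max_def min_def)
  then show ?thesis
    using that[of s] s ds lo hi by (metis diff_ge_0_iff_ge)
qed

section \<open>Integral curves and concavity along diagonals\<close>

text \<open>
  A graph tangent to a field that has negative horizontal component \<open>v\<close> is an integral curve traversed from
  right to left: the time is an antiderivative of \<open>1 / v\<close>, and the solution is its inverse function.
\<close>
lemma integral_curve_graph:
  fixes T T' v :: "real \<Rightarrow> real"
  assumes "p < q" and contv: "continuous_on {p<..<q} v"
    and v: "\<And>x. x \<in> {p<..<q} \<Longrightarrow> v x < 0"
    and dT: "\<And>x. x \<in> {p<..<q} \<Longrightarrow> (T has_real_derivative T' x) (at x)"
    and V: "\<And>x. x \<in> {p<..<q} \<Longrightarrow> V (x, T x) = (v x, T' x * v x)"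
  shows "integral_curve V ((\<lambda>x. (x, T x)) ` {p<..<q})"
proof -
  have "isCont (\<lambda>x. 1 / v x) x" if "ereal p < ereal x" "ereal x < ereal q" for x
    using that contv v[of x] by (auto intro!: continuous_intros simp: continuous_on_eq_continuous_at)
  with \<open>p < q\<close> obtain \<Theta>
    where "\<forall>x. ereal p < ereal x \<longrightarrow> ereal x < ereal q \<longrightarrow> (\<Theta> has_vector_derivative 1 / v x) (at x)"
    using einterval_antiderivative[of "ereal p" "ereal q" "\<lambda>x. 1 / v x"] by force
  then have d\<Theta>: "(\<Theta> has_real_derivative 1 / v x) (at x)" if "x \<in> {p<..<q}" for x
    using that by (simp add: has_real_derivative_iff_has_vector_derivative)
  have cont\<Theta>: "continuous_on {p<..<q} \<Theta>"
    using d\<Theta> DERIV_isCont by (intro continuous_at_imp_continuous_on) blast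
  have less: "\<Theta> y < \<Theta> x" if "x \<in> {p<..<q}" "y \<in> {p<..<q}" "x < y" for x y
    by (rule DERIV_neg_imp_decreasing[OF \<open>x < y\<close>])
       (use that d\<Theta> v in \<open>force intro!: exI[of _ "1 / v _"] simp: divide_neg_pos\<close>)
  have inj: "inj_on \<Theta> {p<..<q}"
  proof (rule inj_onI)
    fix x y assume "x \<in> {p<..<q}" "y \<in> {p<..<q}" "\<Theta> x = \<Theta> y"
    then show "x = y" using less[of x y] less[of y x] by (cases x y rule: linorder_cases) simp_all
  qed
  define g where "g = the_inv_into {p<..<q} \<Theta>"
  have g: "g (\<Theta> x) = x" if "x \<in> {p<..<q}" for x
    unfolding g_def by (rule the_inv_into_f_f[OF inj that])
  have dg: "(g has_real_derivative v x) (at (\<Theta> x))" if x: "x \<in> {p<..<q}" for x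
  proof -
    have "(g has_real_derivative inverse (1 / v x)) (at (\<Theta> x))"
    proof (rule has_field_derivative_inverse_strong[of \<Theta> "1 / v x" x "{p<..<q}" g])
      show "1 / v x \<noteq> 0" using v[OF x] by simp
      show "(\<Theta> has_real_derivative 1 / v x) (at x)" by (rule d\<Theta>[OF x])
    qed (use x g cont\<Theta> in simp_all)
    then show ?thesis by simp
  qed
  define I where "I = \<Theta> ` {p<..<q}"
  define \<gamma> where "\<gamma> s = (g s, T (g s))" for s
  have "open I"
    unfolding I_def
    by (rule injective_eq_1d_open_map_UNIV[OF cont\<Theta> is_interval_oo, THEN iffD1, OF inj, rule_format])
       simp
  moreover have "is_interval I"
    unfolding I_def is_interval_connected_1
    by (rule connected_continuous_image[OF cont\<Theta>]) simp
  moreover have "I \<noteq> {}" using \<open>p < q\<close> by (simp add: I_def)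
  moreover have "(\<gamma> has_vector_derivative V (\<gamma> s)) (at s)" if "s \<in> I" for s
  proof -
    obtain x where x: "x \<in> {p<..<q}" and s: "s = \<Theta> x" using \<open>s \<in> I\<close> unfolding I_def by blast
    have "((\<lambda>s. T (g s)) has_real_derivative T' x * v x) (at s)"
      using DERIV_chain2[of T "T' x" g s] dT[OF x] dg[OF x] g[OF x] unfolding s by simp
    then have "(\<gamma> has_vector_derivative (v x, T' x * v x)) (at s)"
      unfolding \<gamma>_def using dg[OF x] unfolding s has_real_derivative_iff_has_vector_derivative
      by (intro has_vector_derivative_Pair)
    then show ?thesis using V[OF x] g[OF x] by (simp add: \<gamma>_def s)
  qed
  moreover have "\<gamma> ` I = (\<lambda>x. (x, T x)) ` {p<..<q}"
    unfolding I_def image_image \<gamma>_def by (intro image_cong) (auto simp: g)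
  ultimately show ?thesis
    unfolding integral_curve_def by (intro exI[of _ \<gamma>] exI[of _ I]) simp
qed

lemma concave_on_line_if_slope_antimono:
  fixes f f' :: "real \<Rightarrow> real"
  assumes df: "\<And>x. x \<in> {l..r} \<Longrightarrow> (f has_real_derivative f' x) (at x within {l..r})"
    and anti: "\<And>x y. \<lbrakk>l \<le> x; x \<le> y; y \<le> r\<rbrakk> \<Longrightarrow> f' y \<le> f' x"
  shows "concave_on {l..r} f"
  unfolding concave_on_def
proof (rule convex_on_linorderI)
  fix \<theta> x y :: real
  assume \<theta>: "\<theta> > 0" "\<theta> < 1" and xy: "x \<in> {l..r}" "y \<in> {l..r}" "x < y"
  define z where "z = (1 - \<theta>) * x + \<theta> * y"
  have zx: "z - x = \<theta> * (y - x)" and yz: "y - z = (1 - \<theta>) * (y - x)"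
    by (simp_all add: z_def algebra_simps)
  have "0 < z - x" "0 < y - z"
    unfolding zx yz using \<theta> xy by auto
  then have z: "x < z" "z < y" by simp_all
  have mvt: "\<exists>\<xi>. p < \<xi> \<and> \<xi> < q \<and> f q - f p = (q - p) * f' \<xi>"
    if "x \<le> p" "p < q" "q \<le> y" for p q
  proof -
    have "(f has_real_derivative f' u) (at u within {p..q})" if "p \<le> u" "u \<le> q" for u
      by (rule DERIV_subset[OF df]) (use that \<open>x \<le> p\<close> \<open>q \<le> y\<close> xy in auto)
    then have "\<exists>\<xi>\<in>{p<..<q}. f q - f p = f' \<xi> * (q - p)"
      using mvt_simple[OF \<open>p < q\<close>, of f "\<lambda>u. (*) (f' u)"] by (simp add: has_field_derivative_def)
    then show ?thesis by (auto simp: mult.commute)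
  qed
  obtain \<xi> \<eta> where \<xi>: "x < \<xi>" "\<xi> < z" "f z - f x = (z - x) * f' \<xi>"
    and \<eta>: "z < \<eta>" "\<eta> < y" "f y - f z = (y - z) * f' \<eta>"
    using mvt[of x z] mvt[of z y] z by auto
  have "f' \<eta> \<le> f' \<xi>" using anti[of \<xi> \<eta>] \<xi> \<eta> xy by simp
  then have "(\<theta> * (1 - \<theta>) * (y - x)) * f' \<eta> \<le> (\<theta> * (1 - \<theta>) * (y - x)) * f' \<xi>"
    by (rule mult_left_mono) (use \<theta> xy in simp)
  then have "\<theta> * (f y - f z) \<le> (1 - \<theta>) * (f z - f x)"
    unfolding \<xi> \<eta> zx yz by (simp add: algebra_simps)
  then show "- f ((1 - \<theta>) *\<^sub>R x + \<theta> *\<^sub>R y) \<le> (1 - \<theta>) * - f x + \<theta> * - f y"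
    unfolding z_def[symmetric] real_scaleR_def by (simp add: algebra_simps)
qed simp

text \<open>
  Given a gradient, diagonal concavity only asks that the derivative in each of the two diagonal
  directions does not increase when moving in that direction.
\<close>
lemma diagonally_concave_onI:
  fixes B :: "real \<times> real \<Rightarrow> real" and G :: "real \<times> real \<Rightarrow> real \<times> real"
  assumes dB: "\<And>x. x \<in> S \<Longrightarrow> (B has_derivative (\<lambda>h. G x \<bullet> h)) (at x within S)"
    and anti: "\<And>d p q \<tau>. \<lbrakk>d = (1, 1) \<or> d = (1, -1); p \<in> S; q \<in> S; 0 \<le> \<tau>; q = p + \<tau> *\<^sub>R d\<rbrakk>
        \<Longrightarrow> G q \<bullet> d \<le> G p \<bullet> d"
  shows "diagonally_concave_on S B"
  unfolding diagonally_concave_on_def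
proof (intro allI impI)
  fix x y :: "real \<times> real"
  assume "closed_segment x y \<subseteq> S \<and> (\<exists>t. y - x = t *\<^sub>R (1, 1) \<or> y - x = t *\<^sub>R (1, -1))"
  then obtain d t where seg: "closed_segment x y \<subseteq> S" and d: "d = (1, 1) \<or> d = (1, -1)"
    and y: "y = x + t *\<^sub>R d"
    by (metis add.commute diff_add_cancel)
  define \<gamma> where "\<gamma> \<tau> = x + \<tau> *\<^sub>R (y - x)" for \<tau>
  have \<gamma>S: "\<gamma> \<tau> \<in> S" if "\<tau> \<in> {0..1}" for \<tau>
  proof -
    have "\<gamma> \<tau> = (1 - \<tau>) *\<^sub>R x + \<tau> *\<^sub>R y" by (simp add: \<gamma>_def algebra_simps)
    then show ?thesis using seg that unfolding closed_segment_def by auto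
  qed
  have "((\<lambda>\<tau>. B (\<gamma> \<tau>)) has_real_derivative t * (G (\<gamma> \<tau>) \<bullet> d)) (at \<tau> within {0..1})"
    if "\<tau> \<in> {0..1}" for \<tau>
  proof -
    have "(\<gamma> has_derivative (\<lambda>h. h *\<^sub>R (y - x))) (at \<tau> within {0..1})"
      unfolding \<gamma>_def by (auto intro!: derivative_eq_intros)
    moreover have "(B has_derivative (\<lambda>h. G (\<gamma> \<tau>) \<bullet> h)) (at (\<gamma> \<tau>) within \<gamma> ` {0..1})"
      by (rule has_derivative_subset[OF dB[OF \<gamma>S[OF that]]]) (use \<gamma>S in blast)
    ultimately have "((\<lambda>\<tau>. B (\<gamma> \<tau>)) has_derivative (\<lambda>h. G (\<gamma> \<tau>) \<bullet> (h *\<^sub>R (y - x)))) (at \<tau> within {0..1})"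
      by (rule has_derivative_in_compose)
    moreover have "(\<lambda>h. G (\<gamma> \<tau>) \<bullet> (h *\<^sub>R (y - x))) = (*) (t * (G (\<gamma> \<tau>) \<bullet> d))"
      by (rule ext) (simp add: y)
    ultimately show ?thesis
      unfolding has_field_derivative_def by simp
  qed
  then have conc: "concave_on {0..1} (\<lambda>\<tau>. B (\<gamma> \<tau>))"
  proof (rule concave_on_line_if_slope_antimono)
    fix \<sigma> \<tau> :: real assume \<sigma>\<tau>: "0 \<le> \<sigma>" "\<sigma> \<le> \<tau>" "\<tau> \<le> 1"
    have dir: "\<gamma> \<tau> = \<gamma> \<sigma> + ((\<tau> - \<sigma>) * t) *\<^sub>R d" "\<gamma> \<sigma> = \<gamma> \<tau> + ((\<tau> - \<sigma>) * - t) *\<^sub>R d"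
      by (simp_all add: \<gamma>_def y algebra_simps)
    show "t * (G (\<gamma> \<tau>) \<bullet> d) \<le> t * (G (\<gamma> \<sigma>) \<bullet> d)"
    proof (cases "0 \<le> t")
      case True
      then have "G (\<gamma> \<tau>) \<bullet> d \<le> G (\<gamma> \<sigma>) \<bullet> d"
        using \<sigma>\<tau> by (intro anti[OF d _ _ _ dir(1)] \<gamma>S) auto
      then show ?thesis using True by (rule mult_left_mono)
    next
      case False
      then have "G (\<gamma> \<sigma>) \<bullet> d \<le> G (\<gamma> \<tau>) \<bullet> d"
        using \<sigma>\<tau> by (intro anti[OF d _ _ _ dir(2)] \<gamma>S mult_nonneg_nonneg) auto
      then show ?thesis using False by (intro mult_left_mono_neg) auto
    qed
  qed
  show "concave_on (closed_segment x y) B"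
    unfolding concave_on_iff
  proof (intro conjI ballI allI impI)
    fix p q and u v :: real
    assume "p \<in> closed_segment x y" "q \<in> closed_segment x y" and uv: "0 \<le> u" "0 \<le> v" "u + v = 1"
    then obtain \<sigma> \<tau> where st: "\<sigma> \<in> {0..1}" "\<tau> \<in> {0..1}" and pq: "p = \<gamma> \<sigma>" "q = \<gamma> \<tau>"
      by (auto simp: closed_segment_def \<gamma>_def algebra_simps)
    have "u *\<^sub>R p + v *\<^sub>R q = (u + v) *\<^sub>R x + (u * \<sigma> + v * \<tau>) *\<^sub>R (y - x)"
      unfolding pq \<gamma>_def by (simp add: algebra_simps)
    then have "u *\<^sub>R p + v *\<^sub>R q = \<gamma> (u *\<^sub>R \<sigma> + v *\<^sub>R \<tau>)"
      using uv by (simp add: \<gamma>_def)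
    then show "u * B p + v * B q \<le> B (u *\<^sub>R p + v *\<^sub>R q)"
      using conc st uv unfolding concave_on_iff pq by metis
  qed simp
qed

lemma diagonally_concave_on_subset:
  "diagonally_concave_on S B \<Longrightarrow> S' \<subseteq> S \<Longrightarrow> diagonally_concave_on S' B"
  unfolding diagonally_concave_on_def by blast

lemma C1_smooth_on_subset:
  "C1_smooth_on S B \<Longrightarrow> S' \<subseteq> S \<Longrightarrow> C1_smooth_on S' B"
  unfolding C1_smooth_on_def by (meson continuous_on_subset has_derivative_subset subsetD)

section \<open>The function carried by a spine\<close>

text \<open>
  The number \<open>t c\<close> is minus the height of the spine at abscissa \<open>c - \<epsilon>\<close>. Outside \<open>(ul, ur)\<close> the value
  \<open>\<epsilon>\<close> makes the upper rib a full segment of the simple foliation and shrinks the lower rib to a point, so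
  that the three parts of the foliation are described by one function \<open>t\<close>.
\<close>
locale spine_parametrization =
  fixes fp fm t :: "real \<Rightarrow> real" and \<epsilon> ul ur u1 u2 :: real
  assumes smooth_fp: "class_C 2 fp" and smooth_fm: "class_C 2 fm"
    and \<epsilon>_pos: "0 < \<epsilon>"
    and order: "u1 \<le> ul" "ul < ur" "ur \<le> u2"
    and continuous_t: "continuous_on UNIV t"
    and t_outside: "\<And>c. \<not> (ul < c \<and> c < ur) \<Longrightarrow> t c = \<epsilon>"
    and t_inside: "\<And>c. \<lbrakk>ul < c; c < ur\<rbrakk> \<Longrightarrow> 0 < t c \<and> t c < \<epsilon>"
    and D_inside: "\<And>c. \<lbrakk>ul < c; c < ur\<rbrakk> \<Longrightarrow>
          0 < D_plus fp fm (c, t c) \<and> 0 < D_minus fp fm (c, t c)"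
    and D_outside: "\<And>c. \<lbrakk>u1 \<le> c; c \<le> u2; \<not> (ul < c \<and> c < ur)\<rbrakk> \<Longrightarrow>
          0 \<le> D_plus fp fm (c, \<epsilon>) \<and> 0 \<le> D_minus fp fm (c, \<epsilon>)"
    and spine_ode: "\<And>c. \<lbrakk>ul < c; c < ur\<rbrakk> \<Longrightarrow>
          (t has_real_derivative
            ((\<epsilon> + t c) * D_minus fp fm (c, t c) - (\<epsilon> - t c) * D_plus fp fm (c, t c))
            / ((\<epsilon> + t c) * D_minus fp fm (c, t c) + (\<epsilon> - t c) * D_plus fp fm (c, t c))) (at c)"
begin

abbreviation "P \<equiv> deriv fp"
abbreviation "M \<equiv> deriv fm"

text \<open>
  The abscissae of the boundary end points of the two ribs through the spine point with parameter \<open>c\<close>.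
\<close>
definition a :: "real \<Rightarrow> real" where "a c = c + t c"
definition b :: "real \<Rightarrow> real" where "b c = c - t c"
definition N :: "real \<Rightarrow> real" where "N c = (P (a c) - M (b c)) / (2 * t c)"
definition Dp :: "real \<Rightarrow> real" where "Dp c = N c - deriv P (a c)"
definition Dm :: "real \<Rightarrow> real" where "Dm c = N c - deriv M (b c)"
text \<open>
  The horizontal component of the herringbone field along the spine is \<open>- t c * W c\<close>.
\<close>
definition W :: "real \<Rightarrow> real" where "W c = (\<epsilon> + t c) * Dm c + (\<epsilon> - t c) * Dp c"

lemma t_pos: "0 < t c" and t_le: "t c \<le> \<epsilon>"
  using t_inside[of c] t_outside[of c] \<epsilon>_pos by (cases "ul < c \<and> c < ur"; auto)+

lemma D_plus_eq: "D_plus fp fm (c, t c) = Dp c"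
  and D_minus_eq: "D_minus fp fm (c, t c) = Dm c"
  using t_pos[of c]
  by (simp_all add: D_plus_def D_minus_def Dp_def Dm_def N_def a_def b_def numeral_2_eq_2 diff_divide_distrib)

lemma Dp_inside: "\<lbrakk>ul < c; c < ur\<rbrakk> \<Longrightarrow> 0 < Dp c"
  and Dm_inside: "\<lbrakk>ul < c; c < ur\<rbrakk> \<Longrightarrow> 0 < Dm c"
  using D_inside[of c] by (simp_all add: D_plus_eq D_minus_eq)

lemma W_pos: "\<lbrakk>ul < c; c < ur\<rbrakk> \<Longrightarrow> 0 < W c"
  unfolding W_def using Dp_inside Dm_inside t_inside \<epsilon>_pos by (intro add_pos_pos mult_pos_pos) auto

lemma Dp_outside: "\<lbrakk>u1 \<le> c; c \<le> u2; \<not> (ul < c \<and> c < ur)\<rbrakk> \<Longrightarrow> 0 \<le> Dp c"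
  and Dm_outside: "\<lbrakk>u1 \<le> c; c \<le> u2; \<not> (ul < c \<and> c < ur)\<rbrakk> \<Longrightarrow> 0 \<le> Dm c"
  using D_outside[of c] t_outside[of c] D_plus_eq[of c] D_minus_eq[of c] by simp_all

lemma dfp: "(fp has_real_derivative P x) (at x)"
  and dfm: "(fm has_real_derivative M x) (at x)"
  and dP: "(P has_real_derivative deriv P x) (at x)"
  and dM: "(M has_real_derivative deriv M x) (at x)"
  using class_C_has_deriv[OF smooth_fp, of 0 x] class_C_has_deriv[OF smooth_fm, of 0 x]
    class_C_has_deriv[OF smooth_fp, of 1 x] class_C_has_deriv[OF smooth_fm, of 1 x]
  by simp_all

lemma continuous_P: "continuous_on UNIV P"
  and continuous_M: "continuous_on UNIV M"
  and continuous_dP: "continuous_on UNIV (deriv P)"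
  and continuous_dM: "continuous_on UNIV (deriv M)"
  using class_C_continuous_deriv[OF smooth_fp, of 1] class_C_continuous_deriv[OF smooth_fm, of 1]
    class_C_continuous_deriv[OF smooth_fp, of 2] class_C_continuous_deriv[OF smooth_fm, of 2]
  by (simp_all add: numeral_2_eq_2)

lemma continuous_a: "continuous_on UNIV a" and continuous_b: "continuous_on UNIV b"
  unfolding a_def b_def by (intro continuous_intros continuous_t)+

lemma continuous_N: "continuous_on UNIV N"
  unfolding N_def
  by (intro continuous_intros continuous_on_compose2[OF continuous_P continuous_a]
        continuous_on_compose2[OF continuous_M continuous_b] continuous_t)
     (use t_pos in \<open>auto simp: less_imp_neq[symmetric]\<close>)

lemma continuous_Dp: "continuous_on UNIV Dp" and continuous_Dm: "continuous_on UNIV Dm"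
  unfolding Dp_def Dm_def
  by (intro continuous_intros continuous_N continuous_on_compose2[OF continuous_dP continuous_a]
        continuous_on_compose2[OF continuous_dM continuous_b] subset_UNIV)+

lemma dt_inside:
  assumes "ul < c" "c < ur"
  shows "(t has_real_derivative ((\<epsilon> + t c) * Dm c - (\<epsilon> - t c) * Dp c) / W c) (at c)"
  using spine_ode[OF assms] by (simp add: D_plus_eq D_minus_eq W_def)

lemma da_inside:
  assumes "ul < c" "c < ur"
  shows "(a has_real_derivative 2 * (\<epsilon> + t c) * Dm c / W c) (at c)"
proof -
  have "(a has_real_derivative 1 + ((\<epsilon> + t c) * Dm c - (\<epsilon> - t c) * Dp c) / W c) (at c)"
    unfolding a_def by (intro derivative_intros dt_inside assms)
  moreover have "1 + ((\<epsilon> + t c) * Dm c - (\<epsilon> - t c) * Dp c) / W c = 2 * (\<epsilon> + t c) * Dm c / W c"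
    using W_pos[OF assms] by (simp add: field_simps) (simp add: W_def algebra_simps)
  ultimately show ?thesis by simp
qed

lemma db_inside:
  assumes "ul < c" "c < ur"
  shows "(b has_real_derivative 2 * (\<epsilon> - t c) * Dp c / W c) (at c)"
proof -
  have "(b has_real_derivative 1 - ((\<epsilon> + t c) * Dm c - (\<epsilon> - t c) * Dp c) / W c) (at c)"
    unfolding b_def by (intro derivative_intros dt_inside assms)
  moreover have "1 - ((\<epsilon> + t c) * Dm c - (\<epsilon> - t c) * Dp c) / W c = 2 * (\<epsilon> - t c) * Dp c / W c"
    using W_pos[OF assms] by (simp add: field_simps) (simp add: W_def algebra_simps)
  ultimately show ?thesis by simp
qed

lemma dt_outside:
  assumes "c < ul \<or> ur < c"
  shows "(t has_real_derivative 0) (at c)"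
proof -
  have "((\<lambda>_. \<epsilon>) has_real_derivative 0) (at c)" by simp
  then show ?thesis
    by (rule has_field_derivative_transform_within_open[where S = "- {ul..ur}"])
       (use assms t_outside in auto)
qed

lemma da_outside: "c < ul \<or> ur < c \<Longrightarrow> (a has_real_derivative 1) (at c)"
  and db_outside: "c < ul \<or> ur < c \<Longrightarrow> (b has_real_derivative 1) (at c)"
  unfolding a_def b_def using DERIV_add[OF DERIV_ident dt_outside] DERIV_diff[OF DERIV_ident dt_outside]
  by auto

lemma off_ends_cases:
  assumes "c \<notin> {ul, ur}"
  obtains (inside) "ul < c" "c < ur" | (outside) "c < ul \<or> ur < c"
  using assms by force

text \<open>
  Monotonicity of \<open>a\<close> and \<open>b\<close> says that upper ribs, and likewise lower ribs, do not cross.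
\<close>
lemma strict_mono_a: "strict_mono a"
proof (rule strict_monoI)
  fix x y :: real assume "x < y"
  show "a x < a y"
  proof (rule has_real_derivative_pos_off_finite_imp_less[of "{ul, ur}" x y a])
    fix c assume "c \<notin> {ul, ur}"
    then show "\<exists>d. (a has_real_derivative d) (at c) \<and> 0 < d"
    proof (cases rule: off_ends_cases)
      case inside
      then have "0 < 2 * (\<epsilon> + t c) * Dm c / W c"
        using Dm_inside W_pos t_pos[of c] \<epsilon>_pos by (intro divide_pos_pos mult_pos_pos) auto
      then show ?thesis using da_inside[OF inside] by blast
    next
      case outside
      then show ?thesis using da_outside[OF outside] zero_less_one by blast
    qed
  qed (use \<open>x < y\<close> in \<open>auto intro: continuous_on_subset[OF continuous_a]\<close>)
qed

lemma strict_mono_b: "strict_mono b"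
proof (rule strict_monoI)
  fix x y :: real assume "x < y"
  show "b x < b y"
  proof (rule has_real_derivative_pos_off_finite_imp_less[of "{ul, ur}" x y b])
    fix c assume "c \<notin> {ul, ur}"
    then show "\<exists>d. (b has_real_derivative d) (at c) \<and> 0 < d"
    proof (cases rule: off_ends_cases)
      case inside
      then have "0 < 2 * (\<epsilon> - t c) * Dp c / W c"
        using Dp_inside W_pos t_inside by (intro divide_pos_pos mult_pos_pos) auto
      then show ?thesis using db_inside[OF inside] by blast
    next
      case outside
      then show ?thesis using db_outside[OF outside] zero_less_one by blast
    qed
  qed (use \<open>x < y\<close> in \<open>auto intro: continuous_on_subset[OF continuous_b]\<close>)
qed

lemmas a_less = strict_mono_less[OF strict_mono_a] and a_le = strict_mono_less_eq[OF strict_mono_a]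
lemmas b_less = strict_mono_less[OF strict_mono_b] and b_le = strict_mono_less_eq[OF strict_mono_b]

lemma a_surj: "\<exists>c. a c = x"
proof -
  have "a (x - \<epsilon>) \<le> x" "x \<le> a x" using t_le[of "x - \<epsilon>"] t_pos[of x] by (auto simp: a_def)
  then show ?thesis
    using IVT'[of a "x - \<epsilon>" x x] \<epsilon>_pos continuous_on_subset[OF continuous_a] by auto
qed

lemma b_surj: "\<exists>c. b c = x"
proof -
  have "b x \<le> x" "x \<le> b (x + \<epsilon>)" using t_le[of "x + \<epsilon>"] t_pos[of x] by (auto simp: b_def)
  then show ?thesis
    using IVT'[of b x x "x + \<epsilon>"] \<epsilon>_pos continuous_on_subset[OF continuous_b] by auto
qed

definition ia :: "real \<Rightarrow> real" where "ia = inv a"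
definition ib :: "real \<Rightarrow> real" where "ib = inv b"

lemma a_ia [simp]: "a (ia x) = x" and b_ib [simp]: "b (ib x) = x"
  unfolding ia_def ib_def using a_surj b_surj by (metis f_inv_into_f rangeI)+

lemma ia_a [simp]: "ia (a c) = c" and ib_b [simp]: "ib (b c) = c"
  unfolding ia_def ib_def
  by (simp_all add: inv_f_f strict_mono_imp_inj_on strict_mono_a strict_mono_b)

lemma continuous_ia: "continuous_on UNIV ia"
proof (rule continuous_onI_mono)
  have "ia ` UNIV = UNIV" by (metis ia_a surjI)
  then show "open (ia ` UNIV)" by simp
  show "ia x \<le> ia y" if "x \<le> y" for x y using that a_le[of "ia x" "ia y"] by simp
qed

lemma continuous_ib: "continuous_on UNIV ib"
proof (rule continuous_onI_mono)
  have "ib ` UNIV = UNIV" by (metis ib_b surjI)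
  then show "open (ib ` UNIV)" by simp
  show "ib x \<le> ib y" if "x \<le> y" for x y using that b_le[of "ib x" "ib y"] by simp
qed

text \<open>
  Differentiating \<open>2 t N = f\<^sub>+'(a) - f\<^sub>-'(b)\<close> with \<open>a' = 1 + t'\<close> and \<open>b' = 1 - t'\<close>.
\<close>
lemma dN_gen:
  assumes "(t has_real_derivative t') (at c)"
  shows "(N has_real_derivative ((1 - t') * Dm c - (1 + t') * Dp c) / (2 * t c)) (at c)"
proof -
  have da: "(a has_real_derivative 1 + t') (at c)" and db: "(b has_real_derivative 1 - t') (at c)"
    unfolding a_def b_def by (intro derivative_intros assms)+
  have "(N has_real_derivative
      ((deriv P (a c) * (1 + t') - deriv M (b c) * (1 - t')) * (2 * t c) - (P (a c) - M (b c)) * (2 * t'))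
      / (2 * t c * (2 * t c))) (at c)"
    unfolding N_def using t_pos[of c]
    by (intro derivative_intros DERIV_chain2[OF dP da] DERIV_chain2[OF dM db] DERIV_cmult assms) auto
  moreover have "P (a c) - M (b c) = 2 * t c * N c" using t_pos[of c] by (simp add: N_def)
  moreover have "((deriv P (a c) * (1 + t') - deriv M (b c) * (1 - t')) * (2 * t c) - (2 * t c * N c) * (2 * t'))
      / (2 * t c * (2 * t c)) = ((1 - t') * Dm c - (1 + t') * Dp c) / (2 * t c)"
    using t_pos[of c] unfolding Dp_def Dm_def by (simp add: divide_simps) (simp add: algebra_simps)
  ultimately show ?thesis by simp
qed

lemma dN_inside:
  assumes "ul < c" "c < ur"
  shows "(N has_real_derivative - 2 * Dp c * Dm c / W c) (at c)"
proof -
  have "((1 - ((\<epsilon> + t c) * Dm c - (\<epsilon> - t c) * Dp c) / W c) * Dm c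
        - (1 + ((\<epsilon> + t c) * Dm c - (\<epsilon> - t c) * Dp c) / W c) * Dp c) / (2 * t c) = - 2 * Dp c * Dm c / W c"
    using W_pos[OF assms] t_pos[of c] by (simp add: field_simps) (simp add: W_def algebra_simps)
  then show ?thesis using dN_gen[OF dt_inside[OF assms]] by simp
qed

lemma dN_outside:
  assumes "c < ul \<or> ur < c"
  shows "(N has_real_derivative (Dm c - Dp c) / (2 * \<epsilon>)) (at c)"
  using dN_gen[OF dt_outside[OF assms]] t_outside[of c] assms by auto

text \<open>
  The slopes, with respect to the second coordinate, of the function along the two ribs with parameter
  \<open>c\<close>. They are found from the prescribed value at the spine point and from the boundary values; the
  quantity \<open>f\<^sub>-'(b) - (\<epsilon> - t) N\<close> is the derivative of the function in the first coordinate at the spine point.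
\<close>
definition upper_slope_of :: "real \<Rightarrow> real" where
  "upper_slope_of c = (\<epsilon> - t c) * (M (b c) - (\<epsilon> - t c) * N c) / \<epsilon> + (fp (a c) - fm (b c)) / (2 * \<epsilon>)"
definition lower_slope_of :: "real \<Rightarrow> real" where
  "lower_slope_of c = - (\<epsilon> + t c) * (M (b c) - (\<epsilon> - t c) * N c) / \<epsilon> + (fp (a c) - fm (b c)) / (2 * \<epsilon>)"

lemma P_a: "P (a c) = M (b c) + 2 * t c * N c"
  using t_pos[of c] by (simp add: N_def)

text \<open>
  The rib slopes solve \<open>dm = N da\<close> on upper ribs and \<open>dm = -N db\<close> on lower ribs. This is where the spine
  equation is used: it turns \<open>(\<epsilon> - t) N'\<close> into \<open>-D\<^sub>- b'\<close>, after which all terms with \<open>b'\<close> (respectively \<open>a'\<close>)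
  cancel.
\<close>
lemma d_upper_slope_of:
  assumes "c \<notin> {ul, ur}" and da: "(a has_real_derivative a') (at c)"
  shows "(upper_slope_of has_real_derivative N c * a') (at c)"
  using assms(1)
proof (cases rule: off_ends_cases)
  case inside
  define t' where "t' = ((\<epsilon> + t c) * Dm c - (\<epsilon> - t c) * Dp c) / W c"
  define b' where "b' = 2 * (\<epsilon> - t c) * Dp c / W c"
  define N' where "N' = - 2 * Dp c * Dm c / W c"
  have dt: "(t has_real_derivative t') (at c)" and db: "(b has_real_derivative b') (at c)"
    and dN: "(N has_real_derivative N') (at c)"
    unfolding t'_def b'_def N'_def by (intro dt_inside db_inside dN_inside inside)+
  have a': "a' = 2 * (\<epsilon> + t c) * Dm c / W c" using DERIV_unique[OF da da_inside[OF inside]] .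
  have t': "t' = (a' - b') / 2"
    unfolding t'_def a' b'_def using W_pos[OF inside] by (simp add: field_simps)
  have N': "N' * (\<epsilon> - t c) = - b' * Dm c"
    unfolding N'_def b'_def by simp
  have ma: "deriv M (b c) = N c - Dm c" by (simp add: Dm_def)
  have "(upper_slope_of has_real_derivative
      ((0 - t') * (M (b c) - (\<epsilon> - t c) * N c)
        + (deriv M (b c) * b' - ((0 - t') * N c + N' * (\<epsilon> - t c))) * (\<epsilon> - t c)) / \<epsilon>
      + (P (a c) * a' - M (b c) * b') / (2 * \<epsilon>)) (at c)"
    unfolding upper_slope_of_def
    by (intro derivative_intros DERIV_chain2[OF dM db] DERIV_chain2[OF dfm db] DERIV_chain2[OF dfp da]
          dt dN DERIV_cdivide)
  also have "((0 - t') * (M (b c) - (\<epsilon> - t c) * N c)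
        + (deriv M (b c) * b' - ((0 - t') * N c + N' * (\<epsilon> - t c))) * (\<epsilon> - t c)) / \<epsilon>
      + (P (a c) * a' - M (b c) * b') / (2 * \<epsilon>) = N c * a'"
    unfolding N' ma P_a t' using \<epsilon>_pos by (simp add: field_simps)
  finally show ?thesis .
next
  case outside
  then have dt: "(t has_real_derivative 0) (at c)" and db: "(b has_real_derivative 1) (at c)"
    by (rule dt_outside db_outside)+
  have a': "a' = 1" using DERIV_unique[OF da da_outside[OF outside]] .
  have tc: "t c = \<epsilon>" using t_outside outside by auto
  have "(upper_slope_of has_real_derivative
      ((0 - 0) * (M (b c) - (\<epsilon> - t c) * N c)
        + (deriv M (b c) * 1 - ((0 - 0) * N c + (Dm c - Dp c) / (2 * \<epsilon>) * (\<epsilon> - t c))) * (\<epsilon> - t c)) / \<epsilon>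
      + (P (a c) * a' - M (b c) * 1) / (2 * \<epsilon>)) (at c)"
    unfolding upper_slope_of_def
    by (intro derivative_intros DERIV_chain2[OF dM db] DERIV_chain2[OF dfm db] DERIV_chain2[OF dfp da]
          dt dN_outside[OF outside] DERIV_cdivide)
  then show ?thesis
    unfolding a' tc using \<epsilon>_pos by (simp add: N_def tc)
qed

lemma d_lower_slope_of:
  assumes inside: "ul < c" "c < ur" and db: "(b has_real_derivative b') (at c)"
  shows "(lower_slope_of has_real_derivative - N c * b') (at c)"
proof -
  define t' where "t' = ((\<epsilon> + t c) * Dm c - (\<epsilon> - t c) * Dp c) / W c"
  define a' where "a' = 2 * (\<epsilon> + t c) * Dm c / W c"
  define N' where "N' = - 2 * Dp c * Dm c / W c"
  have dt: "(t has_real_derivative t') (at c)" and da: "(a has_real_derivative a') (at c)"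
    and dN: "(N has_real_derivative N') (at c)"
    unfolding t'_def a'_def N'_def by (intro dt_inside da_inside dN_inside inside)+
  have b': "b' = 2 * (\<epsilon> - t c) * Dp c / W c" using DERIV_unique[OF db db_inside[OF inside]] .
  have t': "t' = (a' - b') / 2"
    unfolding t'_def b' a'_def using W_pos[OF inside] by (simp add: field_simps)
  have N': "N' * (\<epsilon> - t c) = - b' * Dm c"
    unfolding N'_def b' by simp
  have ma: "deriv M (b c) = N c - Dm c" by (simp add: Dm_def)
  have "(lower_slope_of has_real_derivative
      (- (0 + t') * (M (b c) - (\<epsilon> - t c) * N c)
        + (deriv M (b c) * b' - ((0 - t') * N c + N' * (\<epsilon> - t c))) * - (\<epsilon> + t c)) / \<epsilon>
      + (P (a c) * a' - M (b c) * b') / (2 * \<epsilon>)) (at c)"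
    unfolding lower_slope_of_def
    by (intro derivative_intros DERIV_chain2[OF dM db] DERIV_chain2[OF dfm db] DERIV_chain2[OF dfp da]
          dt dN DERIV_cdivide)
  also have "(- (0 + t') * (M (b c) - (\<epsilon> - t c) * N c)
        + (deriv M (b c) * b' - ((0 - t') * N c + N' * (\<epsilon> - t c))) * - (\<epsilon> + t c)) / \<epsilon>
      + (P (a c) * a' - M (b c) * b') / (2 * \<epsilon>) = - N c * b'"
    unfolding N' ma P_a t' using \<epsilon>_pos by (simp add: field_simps)
  finally show ?thesis .
qed

lemma continuous_slope_of: "continuous_on UNIV upper_slope_of" "continuous_on UNIV lower_slope_of"
proof -
  have "continuous_on UNIV fp" "continuous_on UNIV fm"
    using class_C_continuous_deriv[OF smooth_fp, of 0] class_C_continuous_deriv[OF smooth_fm, of 0] by auto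
  note c = continuous_on_compose2[OF this(1) continuous_a] continuous_on_compose2[OF this(2) continuous_b]
    continuous_on_compose2[OF continuous_M continuous_b]
  show "continuous_on UNIV upper_slope_of" "continuous_on UNIV lower_slope_of"
    unfolding upper_slope_of_def lower_slope_of_def using \<epsilon>_pos
    by (intro continuous_intros c continuous_N continuous_t; simp)+
qed

text \<open>
  The rib slopes as functions of the boundary abscissa. They are introduced as antiderivatives, since this
  makes them \<open>C\<^sup>1\<close> on the whole line, the end points of the spine included; agreement with the explicit
  slopes is proved afterwards.
\<close>
definition upper_slope :: "real \<Rightarrow> real" where
  "upper_slope = (SOME F. (\<forall>x. (F has_real_derivative N (ia x)) (at x)) \<and> F (a ul) = upper_slope_of ul)"
definition lower_slope :: "real \<Rightarrow> real" where
  "lower_slope = (SOME F. (\<forall>x. (F has_real_derivative - N (ib x)) (at x)) \<and> F (b ul) = lower_slope_of ul)"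

lemma continuous_N_ia: "continuous_on UNIV (\<lambda>x. N (ia x))"
  and continuous_N_ib: "continuous_on UNIV (\<lambda>x. N (ib x))"
  by (intro continuous_on_compose2[OF continuous_N continuous_ia]
       continuous_on_compose2[OF continuous_N continuous_ib] subset_UNIV)+

lemma d_upper_slope: "(upper_slope has_real_derivative N (ia x)) (at x)" and upper_slope_ul: "upper_slope (a ul) = upper_slope_of ul"
  using someI_ex[OF antiderivative_exists[OF continuous_N_ia, of "a ul" "upper_slope_of ul"]]
  unfolding upper_slope_def[symmetric] by auto

lemma d_lower_slope: "(lower_slope has_real_derivative - N (ib x)) (at x)" and lower_slope_ul: "lower_slope (b ul) = lower_slope_of ul"
  using someI_ex[OF antiderivative_exists[OF continuous_on_minus[OF continuous_N_ib], of "b ul" "lower_slope_of ul"]]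
  unfolding lower_slope_def[symmetric] by auto

lemma continuous_upper_slope: "continuous_on UNIV upper_slope" and continuous_lower_slope: "continuous_on UNIV lower_slope"
  using d_upper_slope d_lower_slope by (intro continuous_at_imp_continuous_on ballI; blast intro: DERIV_isCont)+

text \<open>
  Both sides are continuous and have the same derivative except at the ends of the spine.
\<close>
lemma upper_slope_a: "upper_slope (a c) = upper_slope_of c"
proof -
  have eq: "upper_slope (a y) - upper_slope_of y = upper_slope (a x) - upper_slope_of x" if "x \<le> y" for x y
  proof (rule has_real_derivative_zero_off_finite_imp_eq[of "{ul, ur}", OF _ that])
    show "continuous_on {x..y} (\<lambda>c. upper_slope (a c) - upper_slope_of c)"
      by (intro continuous_on_diff continuous_on_compose2[OF continuous_upper_slope]
          continuous_on_subset[OF continuous_a] continuous_on_subset[OF continuous_slope_of(1)] subset_UNIV)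
    fix c assume c: "c \<notin> {ul, ur}"
    then obtain a' where a': "(a has_real_derivative a') (at c)"
      using da_inside da_outside by (cases rule: off_ends_cases) blast+
    have "((\<lambda>c. upper_slope (a c) - upper_slope_of c) has_real_derivative N (ia (a c)) * a' - N c * a') (at c)"
      by (intro derivative_intros DERIV_chain2[OF d_upper_slope a'] d_upper_slope_of c a')
    then show "((\<lambda>c. upper_slope (a c) - upper_slope_of c) has_real_derivative 0) (at c)" by simp
  qed simp
  show ?thesis using eq[of ul c] eq[of c ul] upper_slope_ul by (cases "ul \<le> c") auto
qed

lemma lower_slope_b:
  assumes "ul \<le> c" "c \<le> ur"
  shows "lower_slope (b c) = lower_slope_of c"
proof -
  have "lower_slope (b c) - lower_slope_of c = lower_slope (b ul) - lower_slope_of ul"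
  proof (rule has_real_derivative_zero_off_finite_imp_eq[of "{}", OF _ assms(1)])
    show "continuous_on {ul..c} (\<lambda>c. lower_slope (b c) - lower_slope_of c)"
      by (intro continuous_on_diff continuous_on_compose2[OF continuous_lower_slope]
          continuous_on_subset[OF continuous_b] continuous_on_subset[OF continuous_slope_of(2)] subset_UNIV)
    fix d assume "ul < d" "d < c"
    then have d: "ul < d" "d < ur" using assms by auto
    have "((\<lambda>c. lower_slope (b c) - lower_slope_of c) has_real_derivative
        - N (ib (b d)) * (2 * (\<epsilon> - t d) * Dp d / W d) - - N d * (2 * (\<epsilon> - t d) * Dp d / W d)) (at d)"
      by (intro derivative_intros DERIV_chain2[OF d_lower_slope] d_lower_slope_of db_inside d)
    then show "((\<lambda>c. lower_slope (b c) - lower_slope_of c) has_real_derivative 0) (at d)" by simp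
  qed simp
  then show ?thesis using lower_slope_ul by simp
qed

text \<open>
  Coordinates adapted to the ribs: \<open>ca x\<close> is the parameter of the upper rib whose diagonal line passes
  through \<open>x\<close>, and \<open>cb x\<close> that of the lower rib. The point lies above the spine if and only if
  \<open>ca x \<le> cb x\<close>, and on it if and only if the two agree.
\<close>
definition ca :: "real \<times> real \<Rightarrow> real" where "ca x = ia (fst x - snd x + \<epsilon>)"
definition cb :: "real \<times> real \<Rightarrow> real" where "cb x = ib (fst x + snd x + \<epsilon>)"

lemma a_ca [simp]: "a (ca x) = fst x - snd x + \<epsilon>" and b_cb [simp]: "b (cb x) = fst x + snd x + \<epsilon>"
  by (simp_all add: ca_def cb_def)

lemma a_minus_b: "a c = b c + 2 * t c" by (simp add: a_def b_def)

lemma ca_le_cb_iff: "ca x \<le> cb x \<longleftrightarrow> - t (ca x) \<le> snd x"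
  and cb_le_ca_iff: "cb x \<le> ca x \<longleftrightarrow> snd x \<le> - t (cb x)"
  using b_le[of "ca x" "cb x"] a_minus_b[of "ca x"] a_le[of "cb x" "ca x"] a_minus_b[of "cb x"]
  by auto

lemma cb_less_ca_iff: "cb x < ca x \<longleftrightarrow> snd x < - t (ca x)"
  using ca_le_cb_iff[of x] by auto

lemma ca_eqI: "fst x - snd x + \<epsilon> = a c \<Longrightarrow> ca x = c"
  and cb_eqI: "fst x + snd x + \<epsilon> = b c \<Longrightarrow> cb x = c"
  by (simp_all add: ca_def cb_def)

lemma ab_outside: "\<not> (ul < c \<and> c < ur) \<Longrightarrow> a c = c + \<epsilon>" "\<not> (ul < c \<and> c < ur) \<Longrightarrow> b c = c - \<epsilon>"
  using t_outside[of c] by (auto simp: a_def b_def)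

lemma in_Omega_R:
  assumes "\<not> (ul < c1 \<and> c1 < ur)" "\<not> (ul < c2 \<and> c2 < ur)"
  shows "x \<in> Omega_R \<epsilon> c1 c2 \<longleftrightarrow> \<bar>snd x\<bar> \<le> \<epsilon> \<and> c1 \<le> ca x \<and> ca x \<le> c2"
  using a_le[of c1 "ca x"] a_le[of "ca x" c2] ab_outside(1)[OF assms(1)] ab_outside(1)[OF assms(2)]
  by (cases x) (auto simp: Omega_R_def strip_def)

abbreviation "S \<equiv> Omega_R \<epsilon> u1 u2"

lemma in_S: "x \<in> S \<longleftrightarrow> \<bar>snd x\<bar> \<le> \<epsilon> \<and> u1 \<le> ca x \<and> ca x \<le> u2"
  by (rule in_Omega_R) (use order in auto)

text \<open>
  Points of the strip strictly below the spine exist only where the spine is above the lower boundary.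
\<close>
lemma below_spine:
  assumes "\<bar>snd x\<bar> \<le> \<epsilon>" and "cb x < ca x"
  shows "ul < cb x" and "ca x < ur"
proof -
  have "t (ca x) < \<epsilon>" using assms(2) assms(1) cb_less_ca_iff[of x] by linarith
  then show "ca x < ur" using t_outside[of "ca x"] by force
  have "t (cb x) < \<epsilon>"
    using a_less[of "cb x" "ca x"] a_minus_b[of "cb x"] assms by auto
  then show "ul < cb x" using t_outside[of "cb x"] by force
qed

definition B_up :: "real \<times> real \<Rightarrow> real" where
  "B_up x = fp (fst x - snd x + \<epsilon>) + upper_slope (fst x - snd x + \<epsilon>) * (snd x - \<epsilon>)"
definition B_low :: "real \<times> real \<Rightarrow> real" where
  "B_low x = fm (fst x + snd x + \<epsilon>) + lower_slope (fst x + snd x + \<epsilon>) * (snd x + \<epsilon>)"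
definition grad_up :: "real \<times> real \<Rightarrow> real \<times> real" where
  "grad_up x = (P (fst x - snd x + \<epsilon>) + N (ca x) * (snd x - \<epsilon>),
           upper_slope (fst x - snd x + \<epsilon>) - (P (fst x - snd x + \<epsilon>) + N (ca x) * (snd x - \<epsilon>)))"
definition grad_low :: "real \<times> real \<Rightarrow> real \<times> real" where
  "grad_low x = (M (fst x + snd x + \<epsilon>) - N (cb x) * (snd x + \<epsilon>),
           lower_slope (fst x + snd x + \<epsilon>) + (M (fst x + snd x + \<epsilon>) - N (cb x) * (snd x + \<epsilon>)))"

definition U :: "(real \<times> real) set" where "U = {x. ca x \<le> cb x}"
text \<open>
  The parameters are bounded because outside \<open>[ul, ur]\<close> the extension of \<open>lower_slope\<close> is not the slope of
  a lower rib, and the two pieces need not agree there.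
\<close>
definition L :: "(real \<times> real) set" where "L = {x. cb x \<le> ca x \<and> ul \<le> cb x \<and> cb x \<le> ur}"
definition B :: "real \<times> real \<Rightarrow> real" where "B x = (if x \<in> U then B_up x else B_low x)"
definition G :: "real \<times> real \<Rightarrow> real \<times> real" where "G x = (if x \<in> U then grad_up x else grad_low x)"

lemma S_subset: "S \<subseteq> U \<union> L"
proof
  fix x assume "x \<in> S"
  then show "x \<in> U \<union> L"
    using below_spine[of x] by (cases "ca x \<le> cb x") (auto simp: in_S U_def L_def)
qed

lemma d_B_up: "(B_up has_derivative (\<lambda>h. grad_up x \<bullet> h)) (at x within X)"
proof -
  have d: "((\<lambda>x :: real \<times> real. fst x - snd x + \<epsilon>) has_derivative (\<lambda>h. fst h - snd h)) (at x within X)"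
    by (auto intro!: derivative_eq_intros)
  have "(B_up has_derivative (\<lambda>h. (fst h - snd h) * P (fst x - snd x + \<epsilon>)
      + (upper_slope (fst x - snd x + \<epsilon>) * snd h
         + (fst h - snd h) * N (ia (fst x - snd x + \<epsilon>)) * (snd x - \<epsilon>)))) (at x within X)"
    unfolding B_up_def
    by (rule has_derivative_add[OF DERIV_compose_FDERIV[OF dfp d]
          has_derivative_mult[OF DERIV_compose_FDERIV[OF d_upper_slope d]]])
       (auto intro!: derivative_eq_intros)
  then show ?thesis
    by (rule has_derivative_eq_rhs) (auto simp: grad_up_def ca_def inner_prod_def algebra_simps)
qed

lemma d_B_low: "(B_low has_derivative (\<lambda>h. grad_low x \<bullet> h)) (at x within X)"
proof -
  have d: "((\<lambda>x :: real \<times> real. fst x + snd x + \<epsilon>) has_derivative (\<lambda>h. fst h + snd h)) (at x within X)"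
    by (auto intro!: derivative_eq_intros)
  have "(B_low has_derivative (\<lambda>h. (fst h + snd h) * M (fst x + snd x + \<epsilon>)
      + (lower_slope (fst x + snd x + \<epsilon>) * snd h
         + (fst h + snd h) * - N (ib (fst x + snd x + \<epsilon>)) * (snd x + \<epsilon>)))) (at x within X)"
    unfolding B_low_def
    by (rule has_derivative_add[OF DERIV_compose_FDERIV[OF dfm d]
          has_derivative_mult[OF DERIV_compose_FDERIV[OF d_lower_slope d]]])
       (auto intro!: derivative_eq_intros)
  then show ?thesis
    by (rule has_derivative_eq_rhs) (auto simp: grad_low_def cb_def inner_prod_def algebra_simps)
qed

lemma continuous_ca: "continuous_on UNIV ca" and continuous_cb: "continuous_on UNIV cb"
  unfolding ca_def cb_def
  by (intro continuous_on_compose2[OF continuous_ia] continuous_on_compose2[OF continuous_ib]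
        continuous_intros subset_UNIV)+

lemma continuous_grad_up: "continuous_on UNIV grad_up" and continuous_grad_low: "continuous_on UNIV grad_low"
  unfolding grad_up_def grad_low_def
  by (intro continuous_on_Pair continuous_on_add continuous_on_diff continuous_on_mult
        continuous_on_compose2[OF continuous_P] continuous_on_compose2[OF continuous_M]
        continuous_on_compose2[OF continuous_upper_slope] continuous_on_compose2[OF continuous_lower_slope]
        continuous_on_compose2[OF continuous_N] continuous_ca continuous_cb subset_UNIV
        continuous_on_fst continuous_on_snd continuous_on_id continuous_on_const)+

lemma closed_U: "closed U" and closed_L: "closed L"
  unfolding U_def L_def
  by (intro closed_Collect_le closed_Collect_conj continuous_ca continuous_cb continuous_on_const)+

lemma spine_point:
  assumes "x \<in> U" and "x \<in> L"
  obtains c where "ul \<le> c" "c \<le> ur" "ca x = c" "cb x = c" "snd x = - t c"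
    "fst x - snd x + \<epsilon> = a c" "fst x + snd x + \<epsilon> = b c"
  using that[of "ca x"] assms ca_le_cb_iff[of x] cb_le_ca_iff[of x] a_ca[of x] b_cb[of x]
  unfolding U_def L_def by force

lemma slope_of_difference: "upper_slope_of c - lower_slope_of c = 2 * (M (b c) - (\<epsilon> - t c) * N c)"
  using \<epsilon>_pos by (simp add: upper_slope_of_def lower_slope_of_def field_simps)

lemma B_up_eq_B_low_on_spine:
  assumes "x \<in> U" and "x \<in> L"
  shows "B_up x = B_low x"
proof -
  obtain c where c: "ul \<le> c" "c \<le> ur" and x: "snd x = - t c"
    "fst x - snd x + \<epsilon> = a c" "fst x + snd x + \<epsilon> = b c" using spine_point[OF assms] by metis
  show ?thesis
    unfolding B_up_def B_low_def x(2,3) upper_slope_a lower_slope_b[OF c] unfolding x(1) upper_slope_of_def lower_slope_of_def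
    using \<epsilon>_pos by (simp add: field_simps)
qed

text \<open>
  The two derivatives along the ribs determine the gradient, and the derivatives in the first coordinate
  agree on the spine because \<open>f\<^sub>+'(a) - (\<epsilon> + t) N = f\<^sub>-'(b) - (\<epsilon> - t) N\<close>.
\<close>
lemma grad_up_eq_grad_low_on_spine:
  assumes "x \<in> U" and "x \<in> L"
  shows "grad_up x = grad_low x"
proof -
  obtain c where c: "ul \<le> c" "c \<le> ur" and x: "ca x = c" "cb x = c" "snd x = - t c"
    "fst x - snd x + \<epsilon> = a c" "fst x + snd x + \<epsilon> = b c" using spine_point[OF assms] by metis
  show ?thesis
    unfolding grad_up_def grad_low_def x(4,5) unfolding x(1-3) upper_slope_a lower_slope_b[OF c] P_a
    using slope_of_difference[of c] by (simp add: algebra_simps)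
qed

lemma dB:
  assumes "x \<in> S"
  shows "(B has_derivative (\<lambda>h. G x \<bullet> h)) (at x within S)"
proof -
  have "((\<lambda>x. if x \<in> U then B_up x else B_low x) has_derivative
      (if x \<in> U then (\<lambda>h. grad_up x \<bullet> h) else (\<lambda>h. grad_low x \<bullet> h))) (at x within U \<union> L)"
    by (rule has_derivative_If_within_closures)
       (use assms S_subset B_up_eq_B_low_on_spine grad_up_eq_grad_low_on_spine d_B_up d_B_low closed_U closed_L in auto)
  then have "(B has_derivative (\<lambda>h. G x \<bullet> h)) (at x within U \<union> L)"
    unfolding B_def G_def by (auto split: if_splits)
  then show ?thesis by (rule has_derivative_subset[OF _ S_subset])
qed

lemma C1_smooth_B: "C1_smooth_on S B"
  unfolding C1_smooth_on_def
proof (intro exI conjI ballI)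
  have "continuous_on (U \<union> L) (\<lambda>x. if x \<in> U then grad_up x else grad_low x)"
    by (rule continuous_on_If)
       (use closed_U closed_L grad_up_eq_grad_low_on_spine continuous_on_subset[OF continuous_grad_up]
          continuous_on_subset[OF continuous_grad_low] in auto)
  then show "continuous_on S G"
    unfolding G_def using continuous_on_subset S_subset by blast
qed (rule dB)

text \<open>
  \<open>\<Phi> \<beta> c\<close> is the derivative of the upper piece in direction \<open>(1, -1)\<close>, at the point of the upper rib \<open>c\<close> on
  the line \<open>x\<^sub>1 + x\<^sub>2 + \<epsilon> = \<beta>\<close>; \<open>\<Psi> \<alpha> c\<close> is that of the lower piece in direction \<open>(1, 1)\<close>, at the point of
  the lower rib \<open>c\<close> on the line \<open>x\<^sub>1 - x\<^sub>2 + \<epsilon> = \<alpha>\<close>. In the other diagonal directions the pieces are affine.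
\<close>
definition \<Phi> :: "real \<Rightarrow> real \<Rightarrow> real" where
  "\<Phi> \<beta> c = 2 * P (a c) + N c * (\<beta> - a c - 2 * \<epsilon>) - upper_slope (a c)"
definition \<Psi> :: "real \<Rightarrow> real \<Rightarrow> real" where
  "\<Psi> \<alpha> c = 2 * M (b c) - N c * (b c - \<alpha> + 2 * \<epsilon>) + lower_slope (b c)"

text \<open>
  Concavity of the upper piece across its ribs. Over the spine the derivative of \<open>\<Phi>\<close> is a negative multiple
  of \<open>D\<^sub>+ D\<^sub>- (\<beta> - b c)\<close>, and \<open>b c \<le> \<beta>\<close> says that the point is above the spine. Over the simple
  foliation it is a negative combination of \<open>D\<^sub>+\<close> and \<open>D\<^sub>-\<close> with weights \<open>\<epsilon> + x\<^sub>2\<close> and \<open>\<epsilon> - x\<^sub>2\<close>, which are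
  nonnegative in the strip.
\<close>
lemma \<Phi>_antimono:
  assumes "c1 \<le> c2" "u1 \<le> c1" "c2 \<le> u2" and \<beta>: "b c2 \<le> \<beta>" "\<beta> - a c1 \<le> 2 * \<epsilon>"
  shows "\<Phi> \<beta> c2 \<le> \<Phi> \<beta> c1"
proof (rule has_real_derivative_nonpos_off_finite_imp_ge[of "{ul, ur}", OF _ assms(1)])
  show "continuous_on {c1..c2} (\<Phi> \<beta>)"
    unfolding \<Phi>_def
    by (intro continuous_on_add continuous_on_diff continuous_on_mult continuous_on_const
        continuous_on_compose2[OF continuous_P] continuous_on_compose2[OF continuous_upper_slope]
        continuous_on_subset[OF continuous_a] continuous_on_subset[OF continuous_N] subset_UNIV)
  fix c assume c: "c1 < c" "c < c2" "c \<notin> {ul, ur}"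
  have bc: "b c \<le> \<beta>" and ac: "\<beta> - a c \<le> 2 * \<epsilon>"
    using b_le[of c c2] a_le[of c1 c] c \<beta> by auto
  have d: "(\<Phi> \<beta> has_real_derivative
        - 2 * Dp c * a' + N' * (\<beta> - a c - 2 * \<epsilon>)) (at c)"
    if da: "(a has_real_derivative a') (at c)" and dN: "(N has_real_derivative N') (at c)" for a' N'
  proof -
    have "(\<Phi> \<beta> has_real_derivative
        2 * (deriv P (a c) * a') + (N' * (\<beta> - a c - 2 * \<epsilon>) + (0 - a' - 0) * N c) - N (ia (a c)) * a') (at c)"
      unfolding \<Phi>_def
      by (intro DERIV_add DERIV_diff DERIV_mult DERIV_cmult DERIV_const da dN
          DERIV_chain2[OF dP da] DERIV_chain2[OF d_upper_slope da])
    then show ?thesis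
      by (rule DERIV_cong) (simp add: Dp_def algebra_simps)
  qed
  from c(3) show "\<exists>d. (\<Phi> \<beta> has_real_derivative d) (at c) \<and> d \<le> 0"
  proof (cases rule: off_ends_cases)
    case inside
    have "- 2 * Dp c * (2 * (\<epsilon> + t c) * Dm c / W c) + (- 2 * Dp c * Dm c / W c) * (\<beta> - a c - 2 * \<epsilon>)
        = - (2 * (Dp c * Dm c / W c) * (\<beta> - b c))"
      using W_pos[OF inside] by (simp add: a_minus_b field_simps)
    moreover have "0 \<le> 2 * (Dp c * Dm c / W c) * (\<beta> - b c)"
      using W_pos[OF inside] Dp_inside[OF inside] Dm_inside[OF inside] bc by simp
    ultimately show ?thesis
      using d[OF da_inside[OF inside] dN_inside[OF inside]] by (metis neg_le_0_iff_le)
  next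
    case outside
    then have o: "\<not> (ul < c \<and> c < ur)" by auto
    have pos: "0 \<le> Dp c" "0 \<le> Dm c"
      using Dp_outside[OF _ _ o] Dm_outside[OF _ _ o] c assms by auto
    have "- 2 * Dp c * 1 + (Dm c - Dp c) / (2 * \<epsilon>) * (\<beta> - a c - 2 * \<epsilon>)
        = - ((Dp c * (\<beta> - b c) + Dm c * (2 * \<epsilon> - (\<beta> - a c))) / (2 * \<epsilon>))"
      unfolding ab_outside[OF o] using \<epsilon>_pos by (simp add: field_simps)
    moreover have "0 \<le> (Dp c * (\<beta> - b c) + Dm c * (2 * \<epsilon> - (\<beta> - a c))) / (2 * \<epsilon>)"
      using pos bc ac \<epsilon>_pos by simp
    ultimately show ?thesis
      using d[OF da_outside[OF outside] dN_outside[OF outside]] by (metis neg_le_0_iff_le)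
  qed
qed simp

text \<open>
  Concavity of the lower piece across its ribs: the derivative of \<open>\<Psi>\<close> is a negative multiple of
  \<open>D\<^sub>+ D\<^sub>- (\<alpha> - a c)\<close>, and \<open>a c \<le> \<alpha>\<close> says that the point is below the spine.
\<close>
lemma \<Psi>_antimono:
  assumes "c1 \<le> c2" "ul \<le> c1" "c2 \<le> ur" and \<alpha>: "a c2 \<le> \<alpha>"
  shows "\<Psi> \<alpha> c2 \<le> \<Psi> \<alpha> c1"
proof (rule has_real_derivative_nonpos_off_finite_imp_ge[of "{}", OF _ assms(1)])
  show "continuous_on {c1..c2} (\<Psi> \<alpha>)"
    unfolding \<Psi>_def
    by (intro continuous_on_add continuous_on_diff continuous_on_mult continuous_on_const
        continuous_on_compose2[OF continuous_M] continuous_on_compose2[OF continuous_lower_slope]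
        continuous_on_subset[OF continuous_b] continuous_on_subset[OF continuous_N] subset_UNIV)
  fix c assume c: "c1 < c" "c < c2"
  then have inside: "ul < c" "c < ur" using assms by auto
  have ac: "a c \<le> \<alpha>" using a_le[of c c2] c \<alpha> by auto
  define b' where "b' = 2 * (\<epsilon> - t c) * Dp c / W c"
  define N' where "N' = - 2 * Dp c * Dm c / W c"
  have db: "(b has_real_derivative b') (at c)" and dN: "(N has_real_derivative N') (at c)"
    unfolding b'_def N'_def by (intro db_inside dN_inside inside)+
  have d: "(\<Psi> \<alpha> has_real_derivative
      2 * (deriv M (b c) * b') - (N' * (b c - \<alpha> + 2 * \<epsilon>) + (b' - 0 + 0) * N c) + - N (ib (b c)) * b') (at c)"
    unfolding \<Psi>_def
    by (intro DERIV_add DERIV_diff DERIV_mult DERIV_cmult DERIV_const db dN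
        DERIV_chain2[OF dM db] DERIV_chain2[OF d_lower_slope db])
  have "2 * (deriv M (b c) * b') - (N' * (b c - \<alpha> + 2 * \<epsilon>) + (b' - 0 + 0) * N c) + - N (ib (b c)) * b'
      = - 2 * Dm c * b' - N' * (b c - \<alpha> + 2 * \<epsilon>)"
    unfolding Dm_def by (simp add: algebra_simps)
  also have "\<dots> = - (2 * (Dp c * Dm c / W c) * (\<alpha> - a c))"
    unfolding b'_def N'_def using W_pos[OF inside] by (simp add: a_minus_b field_simps)
  also have "\<dots> \<le> 0"
    using W_pos[OF inside] Dp_inside[OF inside] Dm_inside[OF inside] ac by simp
  finally show "\<exists>d. (\<Psi> \<alpha> has_real_derivative d) (at c) \<and> d \<le> 0"
    using d by blast
qed simp

lemma G_diag:
  "grad_up x \<bullet> (1, 1) = upper_slope (a (ca x))" "grad_up x \<bullet> (1, -1) = \<Phi> (b (cb x)) (ca x)"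
  "grad_low x \<bullet> (1, -1) = - lower_slope (b (cb x))" "grad_low x \<bullet> (1, 1) = \<Psi> (a (ca x)) (cb x)"
  by (simp_all add: grad_up_def grad_low_def \<Phi>_def \<Psi>_def inner_prod_def algebra_simps)

lemma \<Phi>_spine:
  assumes "ul \<le> c" "c \<le> ur"
  shows "\<Phi> (b c) c = - lower_slope (b c)"
proof -
  have eq: "b c - a c - 2 * \<epsilon> = - 2 * (\<epsilon> + t c)" by (simp add: a_minus_b)
  show ?thesis
    unfolding \<Phi>_def eq upper_slope_a lower_slope_b[OF assms] P_a using slope_of_difference[of c] by (simp add: algebra_simps)
qed

lemma \<Psi>_spine:
  assumes "ul \<le> c" "c \<le> ur"
  shows "\<Psi> (a c) c = upper_slope (a c)"
proof -
  have eq: "b c - a c + 2 * \<epsilon> = 2 * (\<epsilon> - t c)" by (simp add: a_minus_b)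
  show ?thesis
    unfolding \<Psi>_def eq upper_slope_a lower_slope_b[OF assms] using slope_of_difference[of c] by (simp add: algebra_simps)
qed

text \<open>
  A diagonal line crosses the spine at most once. On one side of the crossing the function is affine along
  the line, on the other side its derivative is monotone by the two preceding lemmas, and the gradients
  match at the crossing. Replacing the parameter by its minimum with that of the crossing treats points
  on different sides together with points on the same side.
\<close>
lemma diagonally_concave_B: "diagonally_concave_on S B"
proof (rule diagonally_concave_onI[of S B G])
  fix d p q :: "real \<times> real" and \<tau> :: real
  assume d: "d = (1, 1) \<or> d = (1, -1)" and S: "p \<in> S" "q \<in> S" and \<tau>: "0 \<le> \<tau>"
    and q: "q = p + \<tau> *\<^sub>R d"
  from d show "G q \<bullet> d \<le> G p \<bullet> d"
  proof
    assume d: "d = (1, 1)"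
    have ca: "ca q = ca p" by (simp add: ca_def q d)
    have "b (cb p) \<le> b (cb q)" using \<tau> by (simp add: q d)
    then have cb: "cb p \<le> cb q" by (simp only: b_le)
    show ?thesis
    proof (cases "ca p \<le> cb p")
      case True
      then have "p \<in> U" "q \<in> U" using ca cb by (auto simp: U_def)
      then show ?thesis by (simp only: G_def if_True d G_diag ca)
    next
      case False
      then have low: "cb p < ca p" "ul < cb p" "ca p < ur"
        using below_spine[of p] S by (auto simp: in_S)
      define c where "c = min (cb q) (ca p)"
      have "\<Psi> (a (ca p)) c \<le> \<Psi> (a (ca p)) (cb p)"
        by (rule \<Psi>_antimono) (use low cb in \<open>auto simp only: c_def a_le\<close>)
      moreover have "G q \<bullet> d = \<Psi> (a (ca p)) c"
      proof (cases "ca q \<le> cb q")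
        case True
        then have c: "c = ca p" using ca by (simp add: c_def)
        have "G q \<bullet> d = upper_slope (a (ca p))" using True by (simp only: G_def U_def mem_Collect_eq if_True d G_diag ca)
        then show ?thesis unfolding c using \<Psi>_spine[of "ca p"] low by simp
      next
        case False
        then have "c = cb q" using ca by (simp add: c_def)
        then show ?thesis using False by (simp only: G_def U_def mem_Collect_eq if_False d G_diag ca)
      qed
      moreover have "G p \<bullet> d = \<Psi> (a (ca p)) (cb p)"
        using False by (simp only: G_def U_def mem_Collect_eq if_False d G_diag)
      ultimately show ?thesis by simp
    qed
  next
    assume d: "d = (1, -1)"
    have cb: "cb q = cb p" by (simp add: cb_def q d)
    have "a (ca p) \<le> a (ca q)" using \<tau> by (simp add: q d)
    then have ca: "ca p \<le> ca q" by (simp only: a_le)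
    show ?thesis
    proof (cases "ca p \<le> cb p")
      case False
      then have "p \<notin> U" "q \<notin> U" using ca cb by (auto simp: U_def)
      then show ?thesis by (simp only: G_def if_False d G_diag cb)
    next
      case True
      define c where "c = min (ca q) (cb p)"
      have "\<Phi> (b (cb p)) c \<le> \<Phi> (b (cb p)) (ca p)"
      proof (rule \<Phi>_antimono)
        show "ca p \<le> c" "u1 \<le> ca p" "c \<le> u2" using True ca S by (auto simp: c_def in_S)
        show "b c \<le> b (cb p)" unfolding b_le c_def by simp
        show "b (cb p) - a (ca p) \<le> 2 * \<epsilon>" using S by (auto simp: in_S)
      qed
      moreover have "G q \<bullet> d = \<Phi> (b (cb p)) c"
      proof (cases "ca q \<le> cb q")
        case True
        then have "c = ca q" using cb by (simp add: c_def)
        then show ?thesis using True by (simp only: G_def U_def mem_Collect_eq if_True d G_diag cb)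
      next
        case False
        then have c: "c = cb p" using cb by (simp add: c_def)
        have "G q \<bullet> d = - lower_slope (b (cb p))" using False by (simp only: G_def U_def mem_Collect_eq if_False d G_diag cb)
        then show ?thesis
          unfolding c using \<Phi>_spine[of "cb p"] below_spine[of q] False S(2) cb by (auto simp: in_S)
      qed
      moreover have "G p \<bullet> d = \<Phi> (b (cb p)) (ca p)"
        using True by (simp only: G_def U_def mem_Collect_eq if_True d G_diag)
      ultimately show ?thesis by simp
    qed
  qed
qed (rule dB)

definition T :: "real \<Rightarrow> real" where "T u = - t (u + \<epsilon>)"

lemma T_minus [simp]: "T (c - \<epsilon>) = - t c" by (simp add: T_def)

lemma rib_ends: "upper_rib_end \<epsilon> T (c - \<epsilon>) = (a c, \<epsilon>)" "lower_rib_end \<epsilon> T (c - \<epsilon>) = (b c, - \<epsilon>)"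
  by (simp_all add: upper_rib_end_def lower_rib_end_def a_def b_def)

lemma affine_convex: "(1 - \<theta>) *\<^sub>R (c - \<epsilon>, - t c) + \<theta> *\<^sub>R (a c, \<epsilon>)
      = (a c - \<epsilon> + (\<theta> * (\<epsilon> + t c) - t c), \<theta> * (\<epsilon> + t c) - t c)"
  "(1 - \<theta>) *\<^sub>R (c - \<epsilon>, - t c) + \<theta> *\<^sub>R (b c, - \<epsilon>)
      = (b c - \<epsilon> - (- t c - \<theta> * (\<epsilon> - t c)), - t c - \<theta> * (\<epsilon> - t c))"
  by (simp_all add: a_def b_def algebra_simps)

lemma rib_height_upper:
  assumes "0 \<le> \<theta>" "\<theta> \<le> 1"
  shows "- t c \<le> \<theta> * (\<epsilon> + t c) - t c" "\<theta> * (\<epsilon> + t c) - t c \<le> \<epsilon>"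
proof -
  have "0 \<le> \<epsilon> + t c" using t_pos[of c] \<epsilon>_pos by simp
  then show "- t c \<le> \<theta> * (\<epsilon> + t c) - t c" "\<theta> * (\<epsilon> + t c) - t c \<le> \<epsilon>"
    using mult_left_le_one_le[of "\<epsilon> + t c" \<theta>] assms by simp_all
qed

lemma rib_height_lower:
  assumes "0 \<le> \<theta>" "\<theta> \<le> 1"
  shows "- \<epsilon> \<le> - t c - \<theta> * (\<epsilon> - t c)" "- t c - \<theta> * (\<epsilon> - t c) \<le> - t c"
proof -
  have "0 \<le> \<epsilon> - t c" using t_le[of c] by simp
  then show "- \<epsilon> \<le> - t c - \<theta> * (\<epsilon> - t c)" "- t c - \<theta> * (\<epsilon> - t c) \<le> - t c"
    using mult_left_le_one_le[of "\<epsilon> - t c" \<theta>] assms by simp_all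
qed

lemma B_upper_rib:
  assumes "- t c \<le> y"
  shows "B (a c - \<epsilon> + y, y) = fp (a c) + upper_slope (a c) * (y - \<epsilon>)"
proof -
  have "ca (a c - \<epsilon> + y, y) = c" by (rule ca_eqI) simp
  then have "(a c - \<epsilon> + y, y) \<in> U"
    using ca_le_cb_iff[of "(a c - \<epsilon> + y, y)"] assms by (simp add: U_def)
  then show ?thesis by (simp add: B_def B_up_def)
qed

lemma B_lower_rib:
  assumes "y \<le> - t c" and c: "ul \<le> c" "c \<le> ur"
  shows "B (b c - \<epsilon> - y, y) = fm (b c) + lower_slope (b c) * (y + \<epsilon>)"
proof -
  have cb: "cb (b c - \<epsilon> - y, y) = c" by (rule cb_eqI) simp
  then have "(b c - \<epsilon> - y, y) \<in> L"
    using cb_le_ca_iff[of "(b c - \<epsilon> - y, y)"] assms by (simp add: L_def)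
  then have "B (b c - \<epsilon> - y, y) = B_low (b c - \<epsilon> - y, y)"
    using B_up_eq_B_low_on_spine by (auto simp: B_def)
  then show ?thesis by (simp add: B_low_def)
qed

lemma affine_upper: "affine_on_segment B (c - \<epsilon>, T (c - \<epsilon>)) (upper_rib_end \<epsilon> T (c - \<epsilon>))"
  unfolding affine_on_segment_def rib_ends T_minus affine_convex
proof
  fix \<theta> :: real assume "\<theta> \<in> {0..1}"
  then have 1: "B (a c - \<epsilon> + (\<theta> * (\<epsilon> + t c) - t c), \<theta> * (\<epsilon> + t c) - t c)
      = fp (a c) + upper_slope (a c) * (\<theta> * (\<epsilon> + t c) - t c - \<epsilon>)"
    using rib_height_upper by (intro B_upper_rib) auto
  have 2: "B (c - \<epsilon>, - t c) = fp (a c) + upper_slope (a c) * (- t c - \<epsilon>)"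
    using B_upper_rib[of c "- t c"] by (simp add: a_def)
  have 3: "B (a c, \<epsilon>) = fp (a c)"
    using B_upper_rib[of c \<epsilon>] t_pos[of c] \<epsilon>_pos by simp
  show "B (a c - \<epsilon> + (\<theta> * (\<epsilon> + t c) - t c), \<theta> * (\<epsilon> + t c) - t c)
      = (1 - \<theta>) * B (c - \<epsilon>, - t c) + \<theta> * B (a c, \<epsilon>)"
    unfolding 1 2 3 by (simp add: algebra_simps)
qed

lemma affine_lower:
  assumes c: "ul \<le> c" "c \<le> ur"
  shows "affine_on_segment B (c - \<epsilon>, T (c - \<epsilon>)) (lower_rib_end \<epsilon> T (c - \<epsilon>))"
  unfolding affine_on_segment_def rib_ends T_minus affine_convex
proof
  fix \<theta> :: real assume "\<theta> \<in> {0..1}"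
  then have 1: "B (b c - \<epsilon> - (- t c - \<theta> * (\<epsilon> - t c)), - t c - \<theta> * (\<epsilon> - t c))
      = fm (b c) + lower_slope (b c) * (- t c - \<theta> * (\<epsilon> - t c) + \<epsilon>)"
    using rib_height_lower by (intro B_lower_rib c) auto
  have 2: "B (c - \<epsilon>, - t c) = fm (b c) + lower_slope (b c) * (- t c + \<epsilon>)"
    using B_lower_rib[OF _ c, of "- t c"] by (simp add: b_def)
  have 3: "B (b c, - \<epsilon>) = fm (b c)"
    using B_lower_rib[OF _ c, of "- \<epsilon>"] t_le[of c] by simp
  show "B (b c - \<epsilon> - (- t c - \<theta> * (\<epsilon> - t c)), - t c - \<theta> * (\<epsilon> - t c))
      = (1 - \<theta>) * B (c - \<epsilon>, - t c) + \<theta> * B (b c, - \<epsilon>)"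
    unfolding 1 2 3 by (simp add: algebra_simps)
qed

text \<open>
  The prescribed spine value, rewritten by \<open>f\<^sub>+'(a) = f\<^sub>-'(b) + 2 t N\<close>.
\<close>
lemma B_spine: "B (c - \<epsilon>, - t c) = spine_value fp fm \<epsilon> (c - \<epsilon>) (- t c)"
proof -
  have "B (c - \<epsilon>, - t c) = fp (a c) + upper_slope_of c * (- t c - \<epsilon>)"
  proof -
    have "a c - \<epsilon> + - t c = c - \<epsilon>" by (simp add: a_def)
    from B_upper_rib[of c "- t c", unfolded this upper_slope_a] show ?thesis by simp
  qed
  also have "\<dots> = (\<epsilon>\<^sup>2 - (- t c)\<^sup>2) / (2 * \<epsilon> * - t c) *
       ((\<epsilon> - - t c) * M (b c) - (\<epsilon> + - t c) * P (a c))
     + ((\<epsilon> + - t c) * fp (a c) + (\<epsilon> - - t c) * fm (b c)) / (2 * \<epsilon>)"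
    unfolding P_a upper_slope_of_def using \<epsilon>_pos t_pos[of c]
    by (simp add: field_simps power2_eq_square)
  also have "\<dots> = spine_value fp fm \<epsilon> (c - \<epsilon>) (- t c)"
    by (simp add: spine_value_def a_def b_def)
  finally show ?thesis .
qed

lemma boundary_values_B: "boundary_values fp fm \<epsilon> S B"
  unfolding boundary_values_def
proof (intro allI conjI impI)
  fix x1 assume "(x1, \<epsilon>) \<in> S"
  have "(x1, \<epsilon>) \<in> U"
    using ca_le_cb_iff[of "(x1, \<epsilon>)"] t_pos[of "ca (x1, \<epsilon>)"] \<epsilon>_pos by (simp add: U_def)
  then show "B (x1, \<epsilon>) = fp x1" by (simp add: B_def B_up_def)
next
  fix x1 assume "(x1, - \<epsilon>) \<in> S"
  show "B (x1, - \<epsilon>) = fm x1"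
  proof (cases "(x1, - \<epsilon>) \<in> U")
    case True
    define c where "c = ca (x1, - \<epsilon>)"
    have tc: "t c = \<epsilon>"
      using True ca_le_cb_iff[of "(x1, - \<epsilon>)"] t_le[of c] by (simp add: U_def c_def)
    have ac: "a c = x1 + 2 * \<epsilon>" by (simp add: c_def)
    then have "b c = x1" using a_minus_b[of c] tc by simp
    then show ?thesis
      using True ac upper_slope_a[of c] \<epsilon>_pos by (simp add: B_def B_up_def upper_slope_of_def tc field_simps)
  qed (simp add: B_def B_low_def)
qed

text \<open>
  Where \<open>t = \<epsilon>\<close> there is nothing below the spine, and the upper slope is the difference quotient between
  the two boundary values.
\<close>
lemma right_simple_candidate_B:
  assumes "u1 \<le> c1" "c2 \<le> u2" and o: "\<And>c. \<lbrakk>c1 \<le> c; c \<le> c2\<rbrakk> \<Longrightarrow> \<not> (ul < c \<and> c < ur)" and "c1 \<le> c2"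
  shows "right_simple_candidate fp fm \<epsilon> c1 c2 B"
  unfolding right_simple_candidate_def
proof (intro conjI ballI)
  have sub: "Omega_R \<epsilon> c1 c2 \<subseteq> S" using assms by (auto simp: Omega_R_def)
  show "diagonally_concave_on (Omega_R \<epsilon> c1 c2) B"
    by (rule diagonally_concave_on_subset[OF diagonally_concave_B sub])
  fix x assume x: "x \<in> Omega_R \<epsilon> c1 c2"
  define c where "c = ca x"
  have c: "c1 \<le> c" "c \<le> c2" and xe: "\<bar>snd x\<bar> \<le> \<epsilon>"
    using x in_Omega_R[of c1 c2 x] o[of c1] o[of c2] \<open>c1 \<le> c2\<close> by (auto simp: c_def)
  have tc: "t c = \<epsilon>" and ab: "a c = c + \<epsilon>" "b c = c - \<epsilon>"
    using t_outside[OF o[OF c]] ab_outside[OF o[OF c]] by auto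
  have xc: "fst x - snd x = c" using a_ca[of x] ab unfolding c_def[symmetric] by simp
  have "x \<in> U" using ca_le_cb_iff[of x] xe tc by (simp add: U_def c_def)
  then have "B x = fp (c + \<epsilon>) + upper_slope (a c) * (snd x - \<epsilon>)"
    by (simp add: B_def B_up_def xc ab)
  also have "\<dots> = (\<epsilon> + snd x) / (2 * \<epsilon>) * fp (fst x - snd x + \<epsilon>)
      + (\<epsilon> - snd x) / (2 * \<epsilon>) * fm (fst x - snd x - \<epsilon>)"
    unfolding upper_slope_a xc using \<epsilon>_pos by (simp add: upper_slope_of_def tc ab field_simps)
  finally show "case x of (x1, x2) \<Rightarrow> B (x1, x2) = (\<epsilon> + x2) / (2 * \<epsilon>) * fp (x1 - x2 + \<epsilon>)
      + (\<epsilon> - x2) / (2 * \<epsilon>) * fm (x1 - x2 - \<epsilon>)"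
    by (cases x) simp
qed

lemma Omega_E_minus_eq: "Omega_E_minus \<epsilon> c1 c2 = Omega_R \<epsilon> c1 c2"
  by (auto simp: Omega_E_minus_def Omega_R_def strip_def)

text \<open>
  A point above the spine lies on the upper rib with parameter \<open>ca\<close>, a point below it on the lower rib
  with parameter \<open>cb\<close>.
\<close>
lemma herringbone_domain_eq: "herringbone_domain \<epsilon> (ul - \<epsilon>) (ur - \<epsilon>) T = Omega_E_minus \<epsilon> ul ur"
proof (rule set_eqI)
  fix x :: "real \<times> real"
  have "x \<in> herringbone_domain \<epsilon> (ul - \<epsilon>) (ur - \<epsilon>) T \<longleftrightarrow>
      (\<exists>u\<in>{ul - \<epsilon>..ur - \<epsilon>}. x \<in> closed_segment (u, T u) (upper_rib_end \<epsilon> T u) \<or>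
           x \<in> closed_segment (u, T u) (lower_rib_end \<epsilon> T u))"
    by (auto simp: herringbone_domain_def)
  also have "\<dots> \<longleftrightarrow> (\<exists>c. ul \<le> c \<and> c \<le> ur \<and>
      (x \<in> closed_segment (c - \<epsilon>, - t c) (a c, \<epsilon>) \<or> x \<in> closed_segment (c - \<epsilon>, - t c) (b c, - \<epsilon>)))"
    (is "?l \<longleftrightarrow> ?r")
  proof
    assume ?l
    then obtain u where u: "ul - \<epsilon> \<le> u" "u \<le> ur - \<epsilon>"
      and "x \<in> closed_segment (u, T u) (upper_rib_end \<epsilon> T u) \<or>
           x \<in> closed_segment (u, T u) (lower_rib_end \<epsilon> T u)" by auto
    then show ?r using rib_ends[of "u + \<epsilon>"] by (intro exI[of _ "u + \<epsilon>"]) (simp add: T_def)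
  next
    assume ?r
    then obtain c where c: "ul \<le> c" "c \<le> ur" and "x \<in> closed_segment (c - \<epsilon>, - t c) (a c, \<epsilon>) \<or>
      x \<in> closed_segment (c - \<epsilon>, - t c) (b c, - \<epsilon>)" by blast
    then show ?l by (intro bexI[of _ "c - \<epsilon>"]) (simp_all add: rib_ends)
  qed
  also have "\<dots> \<longleftrightarrow> x \<in> Omega_E_minus \<epsilon> ul ur"
  proof
    assume "\<exists>c. ul \<le> c \<and> c \<le> ur \<and>
      (x \<in> closed_segment (c - \<epsilon>, - t c) (a c, \<epsilon>) \<or> x \<in> closed_segment (c - \<epsilon>, - t c) (b c, - \<epsilon>))"
    then obtain c \<theta> where c: "ul \<le> c" "c \<le> ur" and \<theta>: "0 \<le> \<theta>" "\<theta> \<le> 1" and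
      x: "x = (a c - \<epsilon> + (\<theta> * (\<epsilon> + t c) - t c), \<theta> * (\<epsilon> + t c) - t c) \<or>
       x = (b c - \<epsilon> - (- t c - \<theta> * (\<epsilon> - t c)), - t c - \<theta> * (\<epsilon> - t c))"
      unfolding closed_segment_def mem_Collect_eq affine_convex by blast
    have "a ul \<le> a c" "a c \<le> a ur" "b ul \<le> b c" "b c \<le> b ur" using c by (simp_all only: a_le b_le)
    then have ab: "ul + \<epsilon> \<le> a c" "a c \<le> ur + \<epsilon>" "b c \<le> ur - \<epsilon>" by (simp_all add: ab_outside)
    from x show "x \<in> Omega_E_minus \<epsilon> ul ur"
      using rib_height_upper[OF \<theta>, of c] rib_height_lower[OF \<theta>, of c] ab t_le[of c] t_pos[of c]
        a_minus_b[of c]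
      unfolding Omega_E_minus_def by auto
  next
    assume "x \<in> Omega_E_minus \<epsilon> ul ur"
    then have xe: "\<bar>snd x\<bar> \<le> \<epsilon>" and ca: "ul \<le> ca x" "ca x \<le> ur"
      unfolding Omega_E_minus_eq using in_Omega_R[of ul ur x] by auto
    show "\<exists>c. ul \<le> c \<and> c \<le> ur \<and>
      (x \<in> closed_segment (c - \<epsilon>, - t c) (a c, \<epsilon>) \<or> x \<in> closed_segment (c - \<epsilon>, - t c) (b c, - \<epsilon>))"
    proof (cases "ca x \<le> cb x")
      case True
      define c where "c = ca x"
      define \<theta> where "\<theta> = (snd x + t c) / (\<epsilon> + t c)"
      have pos: "0 < \<epsilon> + t c" using t_pos[of c] \<epsilon>_pos by simp
      then have \<theta>: "\<theta> * (\<epsilon> + t c) - t c = snd x" by (simp add: \<theta>_def)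
      have "0 \<le> \<theta>" "\<theta> \<le> 1"
        using True ca_le_cb_iff[of x] xe pos by (auto simp: \<theta>_def c_def field_simps)
      moreover have "x = (1 - \<theta>) *\<^sub>R (c - \<epsilon>, - t c) + \<theta> *\<^sub>R (a c, \<epsilon>)"
        unfolding affine_convex \<theta> by (simp add: c_def)
      ultimately have "x \<in> closed_segment (c - \<epsilon>, - t c) (a c, \<epsilon>)"
        unfolding closed_segment_def by blast
      then show ?thesis using ca c_def by blast
    next
      case False
      define c where "c = cb x"
      define \<theta> where "\<theta> = (- t c - snd x) / (\<epsilon> - t c)"
      have c: "ul < c" "c < ur" using False below_spine[of x] xe by (auto simp: c_def)
      then have pos: "0 < \<epsilon> - t c" using t_inside by simp
      then have \<theta>: "- t c - \<theta> * (\<epsilon> - t c) = snd x" by (simp add: \<theta>_def)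
      have "0 \<le> \<theta>" "\<theta> \<le> 1"
        using False cb_le_ca_iff[of x] xe pos by (auto simp: \<theta>_def c_def field_simps)
      moreover have "x = (1 - \<theta>) *\<^sub>R (c - \<epsilon>, - t c) + \<theta> *\<^sub>R (b c, - \<epsilon>)"
        unfolding affine_convex \<theta> by (simp add: c_def)
      ultimately have "x \<in> closed_segment (c - \<epsilon>, - t c) (b c, - \<epsilon>)"
        unfolding closed_segment_def by blast
      then show ?thesis using c less_imp_le by blast
    qed
  qed
  finally show "x \<in> herringbone_domain \<epsilon> (ul - \<epsilon>) (ur - \<epsilon>) T \<longleftrightarrow> x \<in> Omega_E_minus \<epsilon> ul ur" .
qed

definition t' :: "real \<Rightarrow> real" where
  "t' c = ((\<epsilon> + t c) * Dm c - (\<epsilon> - t c) * Dp c) / W c"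

lemma continuous_W: "continuous_on UNIV W"
  unfolding W_def by (intro continuous_intros continuous_t continuous_Dp continuous_Dm)

lemma abs_t'_less:
  assumes "ul < c" "c < ur"
  shows "\<bar>t' c\<bar> < 1"
proof -
  have "0 < (\<epsilon> + t c) * Dm c" "0 < (\<epsilon> - t c) * Dp c"
    using Dp_inside[OF assms] Dm_inside[OF assms] t_inside[OF assms] \<epsilon>_pos by auto
  then show ?thesis
    using W_pos[OF assms] unfolding t'_def W_def by (auto simp: abs_less_iff field_simps)
qed

text \<open>
  On the shifted spine the herringbone field is \<open>- t W\<close> times the tangent vector \<open>(1, T')\<close>: it runs from
  right to left.
\<close>
lemma right_spine_T: "right_spine fp fm \<epsilon> (ul - \<epsilon>) (ur - \<epsilon>) T"
  unfolding right_spine_def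
proof (intro conjI ballI)
  show "ul - \<epsilon> < ur - \<epsilon>" using order by simp
  show "continuous_on {ul - \<epsilon>..ur - \<epsilon>} T"
    unfolding T_def
    by (intro continuous_on_minus continuous_on_compose2[OF continuous_t] continuous_intros subset_UNIV)
  have dT: "(T has_real_derivative - t' (u + \<epsilon>)) (at u)" if "u \<in> {ul - \<epsilon><..<ur - \<epsilon>}" for u
  proof -
    have "(t has_real_derivative t' (u + \<epsilon>)) (at (u + \<epsilon>))"
      unfolding t'_def by (rule dt_inside) (use that in auto)
    then have "((\<lambda>u. t (u + \<epsilon>)) has_real_derivative t' (u + \<epsilon>) * 1) (at u)"
      by (rule DERIV_chain2[where g = "\<lambda>u. u + \<epsilon>"]) (auto intro!: derivative_eq_intros)
    from DERIV_minus[OF this] show ?thesis unfolding T_def by simp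
  qed
  have ct': "continuous_on {ul<..<ur} t'"
    unfolding t'_def
    by (intro continuous_intros continuous_on_subset[OF continuous_t] continuous_on_subset[OF continuous_Dp]
        continuous_on_subset[OF continuous_Dm] continuous_on_subset[OF continuous_W] subset_UNIV)
       (use W_pos in \<open>force simp: less_imp_neq\<close>)
  show "T C1_differentiable_on {ul - \<epsilon><..<ur - \<epsilon>}"
    unfolding C1_differentiable_on_def
  proof (intro exI conjI ballI)
    show "continuous_on {ul - \<epsilon><..<ur - \<epsilon>} (\<lambda>u. - t' (u + \<epsilon>))"
      by (intro continuous_on_minus continuous_on_compose2[OF ct'] continuous_intros) auto
    show "(T has_vector_derivative - t' (u + \<epsilon>)) (at u)" if "u \<in> {ul - \<epsilon><..<ur - \<epsilon>}" for u
      using dT[OF that] by (simp add: has_real_derivative_iff_has_vector_derivative)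
  qed
  fix u assume u: "u \<in> {ul - \<epsilon><..<ur - \<epsilon>}"
  then show "\<bar>T u\<bar> < \<epsilon>" using t_inside[of "u + \<epsilon>"] by (simp add: T_def)
  show "\<bar>deriv T u\<bar> < 1"
    unfolding DERIV_imp_deriv[OF dT[OF u]] using abs_t'_less[of "u + \<epsilon>"] u by simp
next
  have img: "(\<lambda>u. (u + \<epsilon>, T u)) ` {ul - \<epsilon><..<ur - \<epsilon>} = (\<lambda>c. (c, - t c)) ` {ul<..<ur}"
  proof -
    have "{ul - \<epsilon><..<ur - \<epsilon>} = (\<lambda>c. c - \<epsilon>) ` {ul<..<ur}"
      by (force intro: image_eqI[of _ _ "_ + \<epsilon>"])
    then show ?thesis by (simp add: image_image)
  qed
  show "integral_curve (herringbone_field fp fm \<epsilon>) ((\<lambda>u. (u + \<epsilon>, T u)) ` {ul - \<epsilon><..<ur - \<epsilon>})"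
    unfolding img
  proof (rule integral_curve_graph[where v = "\<lambda>c. - (t c * W c)" and T' = "\<lambda>c. - t' c"])
    show "continuous_on {ul<..<ur} (\<lambda>c. - (t c * W c))"
      by (intro continuous_intros continuous_on_subset[OF continuous_t] continuous_on_subset[OF continuous_W]
          subset_UNIV)
    fix c assume "c \<in> {ul<..<ur}"
    then have c: "ul < c" "c < ur" by auto
    show "- (t c * W c) < 0" using W_pos[OF c] t_pos[of c] by simp
    show "((\<lambda>c. - t c) has_real_derivative - t' c) (at c)"
      unfolding t'_def by (rule DERIV_minus[OF dt_inside[OF c]])
    have "t' c * W c = (\<epsilon> + t c) * Dm c - (\<epsilon> - t c) * Dp c"
      using W_pos[OF c] by (simp add: t'_def)
    then have tw: "- t' c * - (t c * W c) = t c * ((\<epsilon> + t c) * Dm c - (\<epsilon> - t c) * Dp c)"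
      by (metis (no_types, opaque_lifting) minus_mult_minus mult.left_commute)
    have second: "(deriv ^^ 2) fp (a c) = N c - Dp c" "(deriv ^^ 2) fm (b c) = N c - Dm c"
      by (simp_all add: Dp_def Dm_def numeral_2_eq_2)
    have ends: "c - - t c = a c" "c + - t c = b c" by (simp_all add: a_def b_def)
    show "herringbone_field fp fm \<epsilon> (c, - t c) = (- (t c * W c), - t' c * - (t c * W c))"
      unfolding herringbone_field_def split_conv Let_def ends second tw unfolding P_a W_def
      by (simp add: algebra_simps)
  qed (use order in simp)
qed

lemma right_herringbone_candidate_B:
  "right_herringbone_candidate fp fm \<epsilon> (ul - \<epsilon>) (ur - \<epsilon>) T B"
  unfolding right_herringbone_candidate_def herringbone_domain_eq
proof (intro conjI ballI right_spine_T)
  have sub: "Omega_E_minus \<epsilon> ul ur \<subseteq> S"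
    using order by (auto simp: Omega_E_minus_def Omega_R_def strip_def)
  show "C1_smooth_on (Omega_E_minus \<epsilon> ul ur) B"
    by (rule C1_smooth_on_subset[OF C1_smooth_B sub])
  show "diagonally_concave_on (Omega_E_minus \<epsilon> ul ur) B"
    by (rule diagonally_concave_on_subset[OF diagonally_concave_B sub])
  show "boundary_values fp fm \<epsilon> (Omega_E_minus \<epsilon> ul ur) B"
    using boundary_values_B sub unfolding boundary_values_def by blast
  fix u assume "u \<in> {ul - \<epsilon>..ur - \<epsilon>}"
  then have c: "ul \<le> u + \<epsilon>" "u + \<epsilon> \<le> ur" by auto
  show "affine_on_segment B (u, T u) (upper_rib_end \<epsilon> T u)"
    using affine_upper[of "u + \<epsilon>"] by simp
  show "affine_on_segment B (u, T u) (lower_rib_end \<epsilon> T u)"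
    using affine_lower[OF c] by simp
  show "if T u = 0 then (spine_value fp fm \<epsilon> u \<longlongrightarrow> B (u, 0)) (at 0)
      else B (u, T u) = spine_value fp fm \<epsilon> u (T u)"
    using B_spine[of "u + \<epsilon>"] t_pos[of "u + \<epsilon>"] by (simp add: T_def)
qed

theorem candidate_exists:
  "\<exists>B T.
        C1_smooth_on (Omega_R \<epsilon> u1 u2) B \<and>
        diagonally_concave_on (Omega_R \<epsilon> u1 u2) B \<and>
        boundary_values fp fm \<epsilon> (Omega_R \<epsilon> u1 u2) B \<and>
        right_simple_candidate fp fm \<epsilon> u1 ul B \<and>
        right_simple_candidate fp fm \<epsilon> ur u2 B \<and>
        right_herringbone_candidate fp fm \<epsilon> (ul - \<epsilon>) (ur - \<epsilon>) T B \<and>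
        herringbone_domain \<epsilon> (ul - \<epsilon>) (ur - \<epsilon>) T = Omega_E_minus \<epsilon> ul ur \<and>
        T (ul - \<epsilon>) = -\<epsilon> \<and> T (ur - \<epsilon>) = -\<epsilon> \<and>
        (\<forall>u\<in>{ul - \<epsilon>..ur - \<epsilon>}. T u \<noteq> 0)"
proof (intro exI[of _ B] exI[of _ T] conjI ballI)
  show "T u \<noteq> 0" for u using t_pos[of "u + \<epsilon>"] by (simp add: T_def)
  show "right_simple_candidate fp fm \<epsilon> u1 ul B"
    by (rule right_simple_candidate_B) (use order in auto)
  show "right_simple_candidate fp fm \<epsilon> ur u2 B"
    by (rule right_simple_candidate_B) (use order in auto)
qed (simp_all add: C1_smooth_B diagonally_concave_B boundary_values_B right_herringbone_candidate_B
      herringbone_domain_eq t_outside)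

end

section \<open>The spine beyond a double root\<close>

locale double_root_of_D_minus =
  fixes fp fm :: "real \<Rightarrow> real" and u1 u0 u2 \<epsilon>0 :: real
  assumes C4: "class_C 4 fp" "class_C 4 fm"
    and u_order: "u1 < u0" "u0 < u2"
    and \<epsilon>0_pos: "0 < \<epsilon>0"
    and D_plus_pos: "\<And>u. \<lbrakk>u1 \<le> u; u \<le> u2\<rbrakk> \<Longrightarrow> 0 < D_plus fp fm (u, \<epsilon>0)"
    and D_minus_pos: "\<And>u. \<lbrakk>u1 \<le> u; u \<le> u2; u \<noteq> u0\<rbrakk> \<Longrightarrow> 0 < D_minus fp fm (u, \<epsilon>0)"
    and order_2: "root_of_order 2 (\<lambda>u. D_minus fp fm (u, \<epsilon>0)) u0"
begin

abbreviation "dp \<equiv> \<lambda>k. (deriv ^^ k) fp"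
abbreviation "dm \<equiv> \<lambda>k. (deriv ^^ k) fm"

text \<open>
  The numerators \<open>2 t D\<^sub>-\<close> and \<open>2 t D\<^sub>+\<close>, with the partial derivatives of the first. They have no
  denominators, so they are easier to differentiate than \<open>D\<^sub>-\<close> and \<open>D\<^sub>+\<close>, and have the same signs for \<open>t > 0\<close>.
\<close>
definition g :: "real \<Rightarrow> real \<Rightarrow> real" where
  "g c t = dp 1 (c + t) - dm 1 (c - t) - 2 * t * dm 2 (c - t)"
definition h :: "real \<Rightarrow> real \<Rightarrow> real" where
  "h c t = dp 1 (c + t) - dm 1 (c - t) - 2 * t * dp 2 (c + t)"
definition gc :: "real \<Rightarrow> real \<Rightarrow> real" where
  "gc c t = dp 2 (c + t) - dm 2 (c - t) - 2 * t * dm 3 (c - t)"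
definition gt :: "real \<Rightarrow> real \<Rightarrow> real" where
  "gt c t = dp 2 (c + t) - dm 2 (c - t) + 2 * t * dm 3 (c - t)"
definition gcc :: "real \<Rightarrow> real \<Rightarrow> real" where
  "gcc c t = dp 3 (c + t) - dm 3 (c - t) - 2 * t * dm 4 (c - t)"

lemma D_minus_g: "D_minus fp fm (c, t) = g c t / (2 * t)"
  and D_plus_h: "D_plus fp fm (c, t) = h c t / (2 * t)"
  by (simp_all add: D_minus_def D_plus_def g_def h_def)

lemma ddp: "k < 4 \<Longrightarrow> (dp k has_real_derivative dp (Suc k) x) (at x)"
  and ddm: "k < 4 \<Longrightarrow> (dm k has_real_derivative dm (Suc k) x) (at x)"
  using class_C_has_deriv C4 by blast+

lemma dg_c: "((\<lambda>c. g c t) has_real_derivative gc c t) (at c)"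
proof -
  have "((\<lambda>c. g c t) has_real_derivative
      dp (Suc 1) (c + t) * (1 + 0) - dm (Suc 1) (c - t) * (1 - 0)
      - 2 * t * (dm (Suc 2) (c - t) * (1 - 0))) (at c)"
    unfolding g_def
    by (intro DERIV_diff DERIV_cmult DERIV_chain2[OF ddp] DERIV_chain2[OF ddm] DERIV_add DERIV_ident DERIV_const)
       simp_all
  then show ?thesis
    by (rule DERIV_cong) (simp add: gc_def numeral_3_eq_3 numeral_2_eq_2)
qed

lemma dgc_c: "((\<lambda>c. gc c t) has_real_derivative gcc c t) (at c)"
proof -
  have "((\<lambda>c. gc c t) has_real_derivative
      dp (Suc 2) (c + t) * (1 + 0) - dm (Suc 2) (c - t) * (1 - 0)
      - 2 * t * (dm (Suc 3) (c - t) * (1 - 0))) (at c)"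
    unfolding gc_def
    by (intro DERIV_diff DERIV_cmult DERIV_chain2[OF ddp] DERIV_chain2[OF ddm] DERIV_add DERIV_ident DERIV_const)
       simp_all
  then show ?thesis
    by (rule DERIV_cong) (simp add: gcc_def eval_nat_numeral)
qed

lemma dg_t: "((\<lambda>t. g c t) has_real_derivative gt c t) (at t)"
proof -
  have "((\<lambda>t. g c t) has_real_derivative
      dp (Suc 1) (c + t) * (0 + 1) - dm (Suc 1) (c - t) * (0 - 1)
      - (2 * 1 * dm 2 (c - t) + (dm (Suc 2) (c - t) * (0 - 1)) * (2 * t))) (at t)"
    unfolding g_def
    by (intro DERIV_diff DERIV_mult DERIV_cmult DERIV_chain2[OF ddp] DERIV_chain2[OF ddm] DERIV_add DERIV_ident DERIV_const)
       simp_all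
  then show ?thesis
    by (rule DERIV_cong) (simp add: gt_def numeral_3_eq_3 numeral_2_eq_2 algebra_simps)
qed

lemma continuous_dp: "k \<le> 4 \<Longrightarrow> continuous_on UNIV (dp k)"
  and continuous_dm: "k \<le> 4 \<Longrightarrow> continuous_on UNIV (dm k)"
  using class_C_continuous_deriv C4 by blast+

lemma continuous_joint:
  "continuous_on UNIV (\<lambda>z. g (fst z) (snd z))" "continuous_on UNIV (\<lambda>z. h (fst z) (snd z))"
  "continuous_on UNIV (\<lambda>z. gc (fst z) (snd z))" "continuous_on UNIV (\<lambda>z. gt (fst z) (snd z))"
  "continuous_on UNIV (\<lambda>z. gcc (fst z) (snd z))"
proof -
  have "continuous_on UNIV (\<lambda>z :: real \<times> real. dp k (fst z + snd z))"
       "continuous_on UNIV (\<lambda>z :: real \<times> real. dm k (fst z - snd z))" if "k \<le> 4" for k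
    using that
    by (auto intro!: continuous_on_compose2[OF continuous_dp] continuous_on_compose2[OF continuous_dm]
        continuous_intros)
  note c = this
  show "continuous_on UNIV (\<lambda>z. g (fst z) (snd z))" "continuous_on UNIV (\<lambda>z. h (fst z) (snd z))"
    "continuous_on UNIV (\<lambda>z. gc (fst z) (snd z))" "continuous_on UNIV (\<lambda>z. gt (fst z) (snd z))"
    "continuous_on UNIV (\<lambda>z. gcc (fst z) (snd z))"
    unfolding g_def h_def gc_def gt_def gcc_def
    by (intro continuous_on_diff continuous_on_add continuous_on_mult continuous_on_const c
        continuous_on_snd continuous_on_id; simp)+
qed

lemma continuous_compose_joint:
  assumes "continuous_on UNIV (\<lambda>z. F (fst z) (snd z))" "continuous_on X p" "continuous_on X q"
  shows "continuous_on X (\<lambda>x. F (p x) (q x) :: real)"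
  using continuous_on_compose2[OF assms(1) continuous_on_Pair[OF assms(2,3)]] by simp

lemma h_pos: "\<lbrakk>u1 \<le> u; u \<le> u2\<rbrakk> \<Longrightarrow> 0 < h u \<epsilon>0"
  and g_pos: "\<lbrakk>u1 \<le> u; u \<le> u2; u \<noteq> u0\<rbrakk> \<Longrightarrow> 0 < g u \<epsilon>0"
  using D_plus_pos[of u] D_minus_pos[of u] \<epsilon>0_pos by (simp_all add: D_minus_g D_plus_h zero_less_divide_iff)

lemma g_root: "g u0 \<epsilon>0 = 0" and gc_root: "gc u0 \<epsilon>0 = 0" and gcc_root: "gcc u0 \<epsilon>0 \<noteq> 0"
proof -
  have 1: "deriv (\<lambda>u. D_minus fp fm (u, \<epsilon>0)) = (\<lambda>u. gc u \<epsilon>0 / (2 * \<epsilon>0))"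
    unfolding D_minus_g by (intro ext DERIV_imp_deriv DERIV_cdivide dg_c)
  have 2: "deriv (\<lambda>u. gc u \<epsilon>0 / (2 * \<epsilon>0)) = (\<lambda>u. gcc u \<epsilon>0 / (2 * \<epsilon>0))"
    by (intro ext DERIV_imp_deriv DERIV_cdivide dgc_c)
  have low: "(deriv ^^ j) (\<lambda>u. D_minus fp fm (u, \<epsilon>0)) u0 = 0" if "j < 2" for j
    using order_2 that unfolding root_of_order_def by blast
  have "(deriv ^^ 2) (\<lambda>u. D_minus fp fm (u, \<epsilon>0)) u0 \<noteq> 0"
    using order_2 unfolding root_of_order_def by blast
  with low[of 0] low[of 1] show "g u0 \<epsilon>0 = 0" "gc u0 \<epsilon>0 = 0" "gcc u0 \<epsilon>0 \<noteq> 0"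
    using \<epsilon>0_pos by (simp_all add: numeral_2_eq_2 1 2) (simp add: D_minus_g)
qed

text \<open>
  With a negative second derivative, \<open>D\<^sub>-\<close> would be negative just to the right of \<open>u0\<close>.
\<close>
lemma gcc_pos: "0 < gcc u0 \<epsilon>0"
proof (rule ccontr)
  assume "\<not> 0 < gcc u0 \<epsilon>0"
  then have "gcc u0 \<epsilon>0 < 0" using gcc_root by simp
  from DERIV_neg_dec_right[OF dgc_c this] obtain d where "0 < d"
    and d: "\<And>k. \<lbrakk>0 < k; k < d\<rbrakk> \<Longrightarrow> gc (u0 + k) \<epsilon>0 < 0" by (auto simp: gc_root)
  define x where "x = u0 + min (d / 2) (u2 - u0)"
  have x: "u0 < x" "x \<le> u2" "x - u0 < d" using \<open>0 < d\<close> u_order by (auto simp: x_def min_def)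
  have "g x \<epsilon>0 < g u0 \<epsilon>0"
  proof (rule DERIV_neg_imp_decreasing_open[OF x(1)])
    fix y assume "u0 < y" "y < x"
    then have "gc y \<epsilon>0 < 0" using d[of "y - u0"] x by simp
    then show "\<exists>z. ((\<lambda>c. g c \<epsilon>0) has_real_derivative z) (at y) \<and> z < 0" using dg_c by blast
  qed (intro continuous_compose_joint[OF continuous_joint(1)] continuous_intros)
  then show False using g_pos[of x] x u_order g_root by simp
qed

definition lam :: real where "lam = h u0 \<epsilon>0 / \<epsilon>0"

lemma lam_pos: "0 < lam"
  unfolding lam_def using h_pos[of u0] \<epsilon>0_pos u_order by simp

text \<open>
  At the double root \<open>g\<close> and \<open>\<partial>g/\<partial>c\<close> vanish, which leaves one free quantity
  \<open>A = f\<^sub>+''(u\<^sub>0 + \<epsilon>\<^sub>0) - f\<^sub>-''(u\<^sub>0 - \<epsilon>\<^sub>0)\<close>: here \<open>\<partial>g/\<partial>t = 2A\<close> and \<open>h = -2 \<epsilon>\<^sub>0 A\<close>. So the two coefficients of the linearized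
  spine equation are proportional, and \<open>D\<^sub>-\<close> decreases in \<open>t\<close> since \<open>D\<^sub>+\<close> is positive.
\<close>
lemma gt_root: "gt u0 \<epsilon>0 = - lam"
proof -
  have "h u0 \<epsilon>0 = - 2 * \<epsilon>0 * (dp 2 (u0 + \<epsilon>0) - dm 2 (u0 - \<epsilon>0))"
    using g_root by (simp add: g_def h_def algebra_simps)
  moreover have "gt u0 \<epsilon>0 = 2 * (dp 2 (u0 + \<epsilon>0) - dm 2 (u0 - \<epsilon>0))"
    using gc_root by (simp add: gt_def gc_def)
  ultimately show ?thesis using \<epsilon>0_pos by (simp add: lam_def)
qed

text \<open>
  A box around the saddle-node on which the coefficients of the spine equation are constant up to one
  percent. The margin in the barrier estimates is much larger than this.
\<close>
definition box_at :: "real \<Rightarrow> bool" where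
  "box_at \<delta> \<longleftrightarrow> 0 < \<delta> \<and> \<delta> \<le> \<epsilon>0 / 100 \<and> u1 < u0 - \<delta> \<and> u0 + \<delta> < u2 \<and>
     (\<forall>c t. \<bar>c - u0\<bar> \<le> \<delta> \<longrightarrow> \<bar>t - \<epsilon>0\<bar> \<le> \<delta> \<longrightarrow>
        - (101/100 * lam) < gt c t \<and> gt c t < - (99/100 * lam) \<and>
        99/100 * (\<epsilon>0 * lam) < h c t \<and> h c t < 101/100 * (\<epsilon>0 * lam) \<and>
        \<bar>gc c t\<bar> < lam / 100 \<and> 0 < gcc c t)"

lemma box_exists: "\<exists>\<delta>. box_at \<delta>"
proof -
  define V where "V = {z. - (101/100 * lam) < gt (fst z) (snd z) \<and> gt (fst z) (snd z) < - (99/100 * lam) \<and>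
        99/100 * (\<epsilon>0 * lam) < h (fst z) (snd z) \<and> h (fst z) (snd z) < 101/100 * (\<epsilon>0 * lam) \<and>
        \<bar>gc (fst z) (snd z)\<bar> < lam / 100 \<and> 0 < gcc (fst z) (snd z)}"
  have "open V"
    unfolding V_def by (intro open_Collect_conj open_Collect_less continuous_joint continuous_on_const
        continuous_on_rabs)
  moreover have "h u0 \<epsilon>0 = \<epsilon>0 * lam" "0 < \<epsilon>0 * lam"
    using \<epsilon>0_pos mult_pos_pos[OF \<epsilon>0_pos lam_pos] by (simp_all add: lam_def)
  then have "(u0, \<epsilon>0) \<in> V"
    using lam_pos gt_root gc_root gcc_pos by (simp add: V_def)
  ultimately obtain e where e: "0 < e" "ball (u0, \<epsilon>0) e \<subseteq> V"
    unfolding open_contains_ball by blast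
  define \<delta> where "\<delta> = Min {e / 3, \<epsilon>0 / 100, (u0 - u1) / 2, (u2 - u0) / 2}"
  have \<delta>: "0 < \<delta>" "\<delta> \<le> e / 3" "\<delta> \<le> \<epsilon>0 / 100" "\<delta> \<le> (u0 - u1) / 2" "\<delta> \<le> (u2 - u0) / 2"
  proof -
    show "0 < \<delta>" using e \<epsilon>0_pos u_order by (simp add: \<delta>_def)
    have "\<delta> \<le> y" if "y \<in> {e / 3, \<epsilon>0 / 100, (u0 - u1) / 2, (u2 - u0) / 2}" for y
      unfolding \<delta>_def by (rule Min_le) (use that in auto)
    then show "\<delta> \<le> e / 3" "\<delta> \<le> \<epsilon>0 / 100" "\<delta> \<le> (u0 - u1) / 2" "\<delta> \<le> (u2 - u0) / 2"
      by blast+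
  qed
  have "(c, t) \<in> V" if "\<bar>c - u0\<bar> \<le> \<delta>" "\<bar>t - \<epsilon>0\<bar> \<le> \<delta>" for c t
  proof -
    have "dist (u0, \<epsilon>0) (c, t) \<le> \<bar>u0 - c\<bar> + \<bar>\<epsilon>0 - t\<bar>"
      unfolding dist_Pair_Pair dist_real_def by (rule order_trans[OF sqrt_sum_squares_le_sum_abs]) simp
    also have "\<dots> < e" using that \<delta> by linarith
    finally show ?thesis using e by auto
  qed
  then have "box_at \<delta>"
    unfolding box_at_def using \<delta> u_order by (auto simp: V_def)
  then show ?thesis ..
qed

end

text \<open>
  A strip width \<open>\<epsilon>\<close> slightly larger than \<open>\<epsilon>0\<close>. The factor \<open>5\<close> keeps the upper barrier, whose depth is at most
  \<open>4.04 (\<epsilon> - \<epsilon>0)\<close>, inside the box.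
\<close>
locale past_double_root = double_root_of_D_minus +
  fixes \<delta> \<epsilon> :: real
  assumes box: "box_at \<delta>"
    and \<epsilon>: "\<epsilon>0 < \<epsilon>" "5 * (\<epsilon> - \<epsilon>0) \<le> \<delta>"
    and h_pos_eps: "\<And>c. \<lbrakk>u1 \<le> c; c \<le> u2\<rbrakk> \<Longrightarrow> 0 < h c \<epsilon>"
    and g_pos_far: "\<And>c. \<lbrakk>u1 \<le> c; c \<le> u2; \<delta> \<le> \<bar>c - u0\<bar>\<rbrakk> \<Longrightarrow> 0 < g c \<epsilon>"
begin

lemma \<delta>: "0 < \<delta>" "\<delta> \<le> \<epsilon>0 / 100" "u1 < u0 - \<delta>" "u0 + \<delta> < u2"
  using box by (auto simp: box_at_def)

lemma in_box:
  assumes "\<bar>c - u0\<bar> \<le> \<delta>" "\<bar>t - \<epsilon>0\<bar> \<le> \<delta>"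
  shows "- (101/100 * lam) < gt c t" "gt c t < - (99/100 * lam)"
    "99/100 * (\<epsilon>0 * lam) < h c t" "h c t < 101/100 * (\<epsilon>0 * lam)"
    "\<bar>gc c t\<bar> < lam / 100" "0 < gcc c t"
  using box assms unfolding box_at_def by blast+

lemma g_increment:
  assumes c: "\<bar>c - u0\<bar> \<le> \<delta>" and st: "s \<le> t" "\<epsilon>0 - \<delta> \<le> s" "t \<le> \<epsilon>0 + \<delta>"
  shows "99/100 * lam * (t - s) \<le> g c s - g c t" "g c s - g c t \<le> 101/100 * lam * (t - s)"
proof -
  have "99/100 * lam * (t - s) \<le> g c s - g c t \<and> g c s - g c t \<le> 101/100 * lam * (t - s)"
  proof (cases "s = t")
    case False
    then have "s < t" using st by simp
    from MVT2[OF this, of "g c" "gt c"] dg_t obtain x where x: "s < x" "x < t"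
      and eq: "g c t - g c s = (t - s) * gt c x" by blast
    have "\<bar>x - \<epsilon>0\<bar> \<le> \<delta>" using x st by (simp add: abs_le_iff)
    from in_box(1,2)[OF c this] have b: "99/100 * lam \<le> - gt c x" "- gt c x \<le> 101/100 * lam"
      by simp_all
    have "g c s - g c t = (- gt c x) * (t - s)" using eq by (simp add: algebra_simps)
    then show ?thesis
      using mult_right_mono[OF b(1), of "t - s"] mult_right_mono[OF b(2), of "t - s"] \<open>s < t\<close> by simp
  qed simp
  then show "99/100 * lam * (t - s) \<le> g c s - g c t" "g c s - g c t \<le> 101/100 * lam * (t - s)" by auto
qed

lemma g_u0_neg: "g u0 \<epsilon> < 0"
proof -
  have "0 < 99/100 * lam * (\<epsilon> - \<epsilon>0)" using lam_pos \<epsilon> by simp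
  also have "\<dots> \<le> g u0 \<epsilon>0 - g u0 \<epsilon>"
    by (rule g_increment(1)) (use \<epsilon> \<delta> in auto)
  finally show ?thesis using g_root by simp
qed

lemma g_convex: "convex_on {u0 - \<delta>..u0 + \<delta>} (\<lambda>c. g c \<epsilon>)"
proof (rule f''_ge0_imp_convex)
  fix c assume "c \<in> {u0 - \<delta>..u0 + \<delta>}"
  then have "\<bar>c - u0\<bar> \<le> \<delta>" by auto
  then show "0 \<le> gcc c \<epsilon>" using in_box(6)[of c \<epsilon>] \<epsilon> \<delta> by simp
qed (use dg_c dgc_c in auto)

lemma roots_exist:
  obtains ul ur where "u0 - \<delta> < ul" "ul < u0" "u0 < ur" "ur < u0 + \<delta>" "g ul \<epsilon> = 0" "g ur \<epsilon> = 0"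
proof -
  have cont: "continuous_on X (\<lambda>c. g c \<epsilon>)" for X
    by (intro continuous_compose_joint[OF continuous_joint(1)] continuous_intros)
  have "0 < g (u0 - \<delta>) \<epsilon>" "0 < g (u0 + \<delta>) \<epsilon>"
    using g_pos_far[of "u0 - \<delta>"] g_pos_far[of "u0 + \<delta>"] \<delta> by auto
  moreover obtain ul where "u0 - \<delta> \<le> ul" "ul \<le> u0" "g ul \<epsilon> = 0"
    using IVT2'[OF _ _ _ cont, of u0 0 "u0 - \<delta>"] g_u0_neg \<delta> calculation by force
  moreover obtain ur where "u0 \<le> ur" "ur \<le> u0 + \<delta>" "g ur \<epsilon> = 0"
    using IVT'[OF _ _ _ cont, of u0 0 "u0 + \<delta>"] g_u0_neg \<delta> calculation by force
  moreover have "u0 - \<delta> \<noteq> ul" "ul \<noteq> u0" "u0 \<noteq> ur" "ur \<noteq> u0 + \<delta>"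
    using calculation g_u0_neg by auto
  ultimately show ?thesis using that[of ul ur] by simp
qed

definition ul :: real where "ul = (SOME x. u0 - \<delta> < x \<and> x < u0 \<and> g x \<epsilon> = 0)"
definition ur :: real where "ur = (SOME x. u0 < x \<and> x < u0 + \<delta> \<and> g x \<epsilon> = 0)"

lemma ul: "u0 - \<delta> < ul" "ul < u0" "g ul \<epsilon> = 0"
  and ur: "u0 < ur" "ur < u0 + \<delta>" "g ur \<epsilon> = 0"
proof -
  have "\<exists>x. u0 - \<delta> < x \<and> x < u0 \<and> g x \<epsilon> = 0" "\<exists>x. u0 < x \<and> x < u0 + \<delta> \<and> g x \<epsilon> = 0"
    using roots_exist by metis+
  from someI_ex[OF this(1)] someI_ex[OF this(2)]
  show "u0 - \<delta> < ul" "ul < u0" "g ul \<epsilon> = 0" "u0 < ur" "ur < u0 + \<delta>" "g ur \<epsilon> = 0"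
    unfolding ul_def ur_def by auto
qed

lemma g_neg_inside:
  assumes "ul < c" "c < ur"
  shows "g c \<epsilon> < 0"
proof (cases "c \<le> u0")
  case True
  then show ?thesis
    using convex_on_neg_between[OF g_convex, of ul u0 c] assms ul g_u0_neg \<delta> by simp
next
  case False
  then show ?thesis
    using convex_on_neg_between[OF g_convex, of ur u0 c] assms ur g_u0_neg \<delta> by simp
qed

lemma g_nonneg_outside:
  assumes c: "u1 \<le> c" "c \<le> u2" "\<not> (ul < c \<and> c < ur)"
  shows "0 \<le> g c \<epsilon>"
proof (rule ccontr)
  assume neg: "\<not> 0 \<le> g c \<epsilon>"
  then have cu: "\<bar>c - u0\<bar> < \<delta>" using g_pos_far[of c] c by force
  have "c \<noteq> ul" "c \<noteq> ur" using neg ul ur by auto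
  then have "c < ul \<or> ur < c" using c(3) by auto
  then  show False
    using convex_on_neg_between[OF g_convex, of c u0 ul] convex_on_neg_between[OF g_convex, of c u0 ur]
      neg cu ul ur g_u0_neg \<delta> by (auto simp: abs_less_iff)
qed

text \<open>
  The barriers are multiples \<open>\<kappa> Q / \<lambda>\<close> with \<open>Q c = - g c \<epsilon>\<close>. To first order \<open>g c (\<epsilon> - s) = \<lambda> s - Q\<close> and
  \<open>h = \<epsilon>\<^sub>0 \<lambda>\<close>, so on such a curve the ratio of the two terms in \<open>F\<close> is \<open>(2 \<epsilon> - s) g / (s h) = 2 (1 - 1/\<kappa>)\<close>. It is
  one, and \<open>F\<close> vanishes, for \<open>\<kappa> = 2\<close>; it is \<open>1/2\<close> for \<open>\<kappa> = 4/3\<close> and \<open>3/2\<close> for \<open>\<kappa> = 4\<close>. The curve on which \<open>D\<^sub>-\<close>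
  vanishes is \<open>\<kappa> = 1\<close>, so the spine stays on the side where \<open>D\<^sub>-\<close> is positive.
\<close>
definition \<alpha> :: "real \<Rightarrow> real" where "\<alpha> c = 4/3 * (- g c \<epsilon> / lam)"
definition \<beta> :: "real \<Rightarrow> real" where "\<beta> c = 4 * (- g c \<epsilon> / lam)"
definition F :: "real \<Rightarrow> real \<Rightarrow> real" where
  "F c s = (s * h c (\<epsilon> - s) - (2 * \<epsilon> - s) * g c (\<epsilon> - s)) / (s * h c (\<epsilon> - s) + (2 * \<epsilon> - s) * g c (\<epsilon> - s))"

text \<open>
  First-order estimates between the barriers. The depth is bounded by \<open>Q \<le> 1.01 \<lambda> (\<epsilon> - \<epsilon>\<^sub>0)\<close>, which holds
  because \<open>g\<close> is nonnegative at the width \<open>\<epsilon>\<^sub>0\<close>.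
\<close>
lemma strip:
  assumes c: "ul < c" "c < ur" and s: "\<alpha> c \<le> s" "s \<le> \<beta> c"
  shows "0 < s" "s < \<delta>" "\<bar>\<epsilon> - s - \<epsilon>0\<bar> \<le> \<delta>" "\<bar>c - u0\<bar> \<le> \<delta>"
    and "99/100 * (\<epsilon>0 * lam * s) \<le> s * h c (\<epsilon> - s)" "s * h c (\<epsilon> - s) \<le> 101/100 * (\<epsilon>0 * lam * s)"
    and "199/100 * \<epsilon>0 \<le> 2 * \<epsilon> - s" "2 * \<epsilon> - s \<le> 201/100 * \<epsilon>0"
    and "g c \<epsilon> + 99/100 * (lam * s) \<le> g c (\<epsilon> - s)" "g c (\<epsilon> - s) \<le> g c \<epsilon> + 101/100 * (lam * s)"
    and "0 < g c (\<epsilon> - s)" "0 < h c (\<epsilon> - s)"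
proof -
  have neg: "g c \<epsilon> < 0" by (rule g_neg_inside[OF c])
  show cu: "\<bar>c - u0\<bar> \<le> \<delta>" using c ul ur by auto
  have "0 < \<alpha> c"
    unfolding \<alpha>_def using neg lam_pos by (intro mult_pos_pos divide_pos_pos) simp_all
  then show s0: "0 < s" using s by simp
  have "0 \<le> g c \<epsilon>0"
    using g_pos[of c] g_root c ul ur \<delta> by (cases "c = u0") auto
  moreover have "g c \<epsilon>0 - g c \<epsilon> \<le> 101/100 * lam * (\<epsilon> - \<epsilon>0)"
    by (rule g_increment(2)[OF cu]) (use \<epsilon> \<delta> in auto)
  ultimately have "- g c \<epsilon> \<le> (101/100 * (\<epsilon> - \<epsilon>0)) * lam" by (simp add: algebra_simps)
  then have "- g c \<epsilon> / lam \<le> 101/100 * (\<epsilon> - \<epsilon>0)" using lam_pos by (simp only: pos_divide_le_eq)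
  then have "s \<le> 404/100 * (\<epsilon> - \<epsilon>0)" using s unfolding \<beta>_def by linarith
  also have "\<dots> < 5 * (\<epsilon> - \<epsilon>0)" using \<epsilon>(1) by simp
  finally have sle: "s < 5 * (\<epsilon> - \<epsilon>0)" .
  then show s\<delta>: "s < \<delta>" using \<epsilon>(2) by linarith
  have \<epsilon>5: "5 * \<epsilon> \<le> 5 * \<epsilon>0 + \<delta>" using \<epsilon>(2) by (simp add: algebra_simps)
  show box_t: "\<bar>\<epsilon> - s - \<epsilon>0\<bar> \<le> \<delta>"
    using s\<delta> s0 \<epsilon>(1) \<epsilon>5 by (simp add: abs_le_iff)
  note b = in_box[OF cu box_t]
  show "0 < h c (\<epsilon> - s)" using b(3) mult_pos_pos[OF \<epsilon>0_pos lam_pos] by linarith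
  show "99/100 * (\<epsilon>0 * lam * s) \<le> s * h c (\<epsilon> - s)" "s * h c (\<epsilon> - s) \<le> 101/100 * (\<epsilon>0 * lam * s)"
    using mult_right_mono[OF less_imp_le[OF b(3)], of s] mult_right_mono[OF less_imp_le[OF b(4)], of s] s0
    by (simp_all add: mult_ac)
  show "199/100 * \<epsilon>0 \<le> 2 * \<epsilon> - s" "2 * \<epsilon> - s \<le> 201/100 * \<epsilon>0"
    using s\<delta> s0 \<epsilon>(1) \<epsilon>5 \<delta>(2) by linarith+
  show lower: "g c \<epsilon> + 99/100 * (lam * s) \<le> g c (\<epsilon> - s)"
    and "g c (\<epsilon> - s) \<le> g c \<epsilon> + 101/100 * (lam * s)"
  proof -
    have "\<epsilon> - s \<le> \<epsilon>" "\<epsilon>0 - \<delta> \<le> \<epsilon> - s" "\<epsilon> \<le> \<epsilon>0 + \<delta>"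
      using s0 s\<delta> \<epsilon>5 \<epsilon>(1) by simp_all
    from g_increment[OF cu this]
    show "g c \<epsilon> + 99/100 * (lam * s) \<le> g c (\<epsilon> - s)" "g c (\<epsilon> - s) \<le> g c \<epsilon> + 101/100 * (lam * s)"
      by (simp_all add: mult.assoc)
  qed
  have "- g c \<epsilon> \<le> 3/4 * (lam * s)" using s(1) lam_pos by (simp add: \<alpha>_def field_simps)
  then show "0 < g c (\<epsilon> - s)" using lower mult_pos_pos[OF lam_pos s0] by linarith
qed

lemma barriers_F:
  assumes c: "ul < c" "c < ur"
  shows "1/50 \<le> F c (\<alpha> c)" "F c (\<beta> c) \<le> - 1/25"
proof -
  have neg: "g c \<epsilon> < 0" by (rule g_neg_inside[OF c])
  have le: "\<alpha> c \<le> \<beta> c" using neg lam_pos by (simp add: \<alpha>_def \<beta>_def field_simps)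
  have x: "0 < s * h c (\<epsilon> - s)" "0 < (2 * \<epsilon> - s) * g c (\<epsilon> - s)" if "\<alpha> c \<le> s" "s \<le> \<beta> c" for s
    using strip(1,7,11,12)[OF c that] \<epsilon>0_pos by auto
  show "1/50 \<le> F c (\<alpha> c)"
    unfolding F_def
  proof (rule ratio_bounds(1))
    define s where "s = \<alpha> c"
    have s: "\<alpha> c \<le> s" "s \<le> \<beta> c" using le by (auto simp: s_def)
    note S = strip[OF c s]
    have "g c \<epsilon> = - (3/4 * (lam * s))" using lam_pos by (simp add: s_def \<alpha>_def)
    then have "g c (\<epsilon> - s) \<le> 26/100 * (lam * s)" using S(10) by linarith
    then have "(2 * \<epsilon> - s) * g c (\<epsilon> - s) \<le> (201/100 * \<epsilon>0) * (26/100 * (lam * s))"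
      using S(8,11) \<epsilon>0_pos by (intro mult_mono) auto
    moreover have "0 < \<epsilon>0 * lam * s" using \<epsilon>0_pos lam_pos S(1) by simp
    ultimately show "51 * ((2 * \<epsilon> - \<alpha> c) * g c (\<epsilon> - \<alpha> c)) \<le> 49 * (\<alpha> c * h c (\<epsilon> - \<alpha> c))"
      using S(5) unfolding s_def[symmetric] by (simp add: mult.assoc)
  qed (use x le in auto)
  show "F c (\<beta> c) \<le> - 1/25"
    unfolding F_def
  proof (rule ratio_bounds(2))
    define s where "s = \<beta> c"
    have s: "\<alpha> c \<le> s" "s \<le> \<beta> c" using le by (auto simp: s_def)
    note S = strip[OF c s]
    have "g c \<epsilon> = - (1/4 * (lam * s))" using lam_pos by (simp add: s_def \<beta>_def)
    then have "74/100 * (lam * s) \<le> g c (\<epsilon> - s)" using S(9) by linarith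
    then have "(199/100 * \<epsilon>0) * (74/100 * (lam * s)) \<le> (2 * \<epsilon> - s) * g c (\<epsilon> - s)"
      using S(7,1) \<epsilon>0_pos lam_pos by (intro mult_mono) auto
    moreover have "0 < \<epsilon>0 * lam * s" using \<epsilon>0_pos lam_pos S(1) by simp
    ultimately show "26 * (\<beta> c * h c (\<epsilon> - \<beta> c)) \<le> 24 * ((2 * \<epsilon> - \<beta> c) * g c (\<epsilon> - \<beta> c))"
      using S(6) unfolding s_def[symmetric] by (simp add: mult.assoc)
  qed (use x le in auto)
qed

lemma spine_depth_exists:
  obtains s where "continuous_on {ul..ur} s" "s ul = 0"
    and "\<And>c. c \<in> {ul..ur} \<Longrightarrow> \<alpha> c \<le> s c \<and> s c \<le> \<beta> c"
    and "\<And>c. c \<in> {ul<..<ur} \<Longrightarrow> (s has_real_derivative F c (s c)) (at c)"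
proof (rule ode_between_barriers[of ul ur \<alpha> \<beta> F 0 "\<lambda>c. 4/3 * (- gc c \<epsilon> / lam)" "\<lambda>c. 4 * (- gc c \<epsilon> / lam)"])
  show "ul < ur" using ul ur by simp
  let ?X = "{(x, y). ul < x \<and> x < ur \<and> \<alpha> x \<le> y \<and> y \<le> \<beta> x}"
  have "snd z * h (fst z) (\<epsilon> - snd z) + (2 * \<epsilon> - snd z) * g (fst z) (\<epsilon> - snd z) \<noteq> 0"
    if "z \<in> ?X" for z
    using that strip(1,7,11,12)[of "fst z" "snd z"] \<epsilon>0_pos
    by (intro less_imp_neq[symmetric] add_pos_pos mult_pos_pos) auto
  then have "continuous_on ?X (\<lambda>z. F (fst z) (snd z))"
    unfolding F_def
    by (intro continuous_on_divide continuous_on_add continuous_on_diff continuous_on_mult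
        continuous_compose_joint[OF continuous_joint(1)] continuous_compose_joint[OF continuous_joint(2)]
        continuous_on_fst continuous_on_snd continuous_on_id continuous_on_const) auto
  then show "continuous_on ?X (\<lambda>(x, y). F x y)" by (simp add: case_prod_unfold)
  have cont: "continuous_on X (\<lambda>c. g c \<epsilon>)" for X
    by (intro continuous_compose_joint[OF continuous_joint(1)] continuous_intros)
  show "continuous_on {ul..ur} \<alpha>" "continuous_on {ul..ur} \<beta>"
    unfolding \<alpha>_def \<beta>_def using lam_pos by (intro continuous_intros cont; simp)+
  show "\<bar>F c s\<bar> \<le> 1" if "ul < c" "c < ur" "\<alpha> c \<le> s" "s \<le> \<beta> c" for c s
    unfolding F_def using strip(1,7,11,12)[OF that] \<epsilon>0_pos by (intro ratio_bounds(3) mult_pos_pos) auto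
  show "\<alpha> c \<le> \<beta> c" if "ul \<le> c" "c \<le> ur" for c
  proof -
    have "g c \<epsilon> \<le> 0" using g_neg_inside[of c] ul ur that by (cases "c = ul \<or> c = ur") auto
    then show ?thesis using lam_pos by (simp add: \<alpha>_def \<beta>_def field_simps)
  qed
  show "\<alpha> ul \<le> 0" "0 \<le> \<beta> ul" by (simp_all add: \<alpha>_def \<beta>_def ul)
  show "(\<alpha> has_real_derivative 4/3 * (- gc c \<epsilon> / lam)) (at c)"
    "(\<beta> has_real_derivative 4 * (- gc c \<epsilon> / lam)) (at c)" for c
    unfolding \<alpha>_def \<beta>_def by (intro DERIV_cmult DERIV_cdivide DERIV_minus dg_c)+
  fix c assume c: "ul < c" "c < ur"
  have "\<bar>gc c \<epsilon>\<bar> < lam / 100"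
    using in_box(5)[of c \<epsilon>] c ul ur \<epsilon> \<delta> by auto
  then have "- gc c \<epsilon> / lam \<le> 1/100" "- 1/100 \<le> - gc c \<epsilon> / lam"
    using lam_pos by (auto simp: field_simps abs_less_iff)
  then show "4/3 * (- gc c \<epsilon> / lam) \<le> F c (\<alpha> c)" "F c (\<beta> c) \<le> 4 * (- gc c \<epsilon> / lam)"
    using barriers_F[OF c] by linarith+
qed (rule that)

text \<open>
  In the variable \<open>t = \<epsilon> - s\<close> the equation \<open>s' = F\<close> is the spine equation: the denominator \<open>2 t\<close> of \<open>D\<^sub>+\<close> and
  \<open>D\<^sub>-\<close> cancels in the quotient.
\<close>
lemma spine_parametrization_exists: "\<exists>t. spine_parametrization fp fm t \<epsilon> ul ur u1 u2"
proof -
  obtain s where s: "continuous_on {ul..ur} s" "s ul = 0"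
    and bar: "\<And>c. c \<in> {ul..ur} \<Longrightarrow> \<alpha> c \<le> s c \<and> s c \<le> \<beta> c"
    and ds: "\<And>c. c \<in> {ul<..<ur} \<Longrightarrow> (s has_real_derivative F c (s c)) (at c)"
    using spine_depth_exists by metis
  have sur: "s ur = 0" using bar[of ur] ul ur by (simp add: \<alpha>_def \<beta>_def)
  define t where "t c = \<epsilon> - s (max ul (min ur c))" for c
  have ti: "t c = \<epsilon> - s c" if "ul < c" "c < ur" for c
    using that by (simp add: t_def)
  have S: "0 < s c" "s c < \<delta>" "0 < g c (t c)" "0 < h c (t c)" if "ul < c" "c < ur" for c
    using strip(1,2,11,12)[OF that, of "s c"] bar[of c] that by (auto simp: ti)
  have e0: "0 < \<epsilon>" "\<delta> < \<epsilon>" using \<epsilon> \<epsilon>0_pos \<delta> by linarith+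
  have tpos: "0 < t c" if "ul < c" "c < ur" for c
    using S(2)[OF that] e0 by (simp add: ti[OF that])
  have "spine_parametrization fp fm t \<epsilon> ul ur u1 u2"
  proof
    show "class_C 2 fp" "class_C 2 fm" using C4 class_C_mono[of 4] by auto
    show "0 < \<epsilon>" by (rule e0)
    show "u1 \<le> ul" "ul < ur" "ur \<le> u2" using ul ur \<delta> by auto
    show "continuous_on UNIV t"
      unfolding t_def
      by (intro continuous_on_diff continuous_on_const continuous_on_compose2[OF s(1)]
          continuous_on_max continuous_on_min continuous_on_id) (use ul ur in auto)
    show "t c = \<epsilon>" if "\<not> (ul < c \<and> c < ur)" for c
      using that s sur ul ur by (cases "c \<le> ul") (auto simp: t_def max_def min_def)
    fix c
    show "0 \<le> D_plus fp fm (c, \<epsilon>) \<and> 0 \<le> D_minus fp fm (c, \<epsilon>)"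
      if "u1 \<le> c" "c \<le> u2" "\<not> (ul < c \<and> c < ur)"
      using h_pos_eps[of c] g_nonneg_outside[OF that] that e0 by (simp add: D_plus_h D_minus_g)
    assume c: "ul < c" "c < ur"
    show "0 < t c \<and> t c < \<epsilon>" using tpos[OF c] S(1)[OF c] by (simp add: ti[OF c])
    show "0 < D_plus fp fm (c, t c) \<and> 0 < D_minus fp fm (c, t c)"
      using S[OF c] tpos[OF c] by (simp add: D_plus_h D_minus_g)
    have "((\<lambda>c. \<epsilon> - s c) has_real_derivative 0 - F c (s c)) (at c)"
      using c by (intro DERIV_diff DERIV_const ds) simp
    then have "(t has_real_derivative 0 - F c (s c)) (at c)"
      by (rule has_field_derivative_transform_within_open[where S = "{ul<..<ur}"]) (use c ti in auto)
    moreover have "0 - F c (s c) = ((\<epsilon> + t c) * D_minus fp fm (c, t c) - (\<epsilon> - t c) * D_plus fp fm (c, t c))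
            / ((\<epsilon> + t c) * D_minus fp fm (c, t c) + (\<epsilon> - t c) * D_plus fp fm (c, t c))"
    proof -
      define x y where "x = s c * h c (t c)" and "y = (\<epsilon> + t c) * g c (t c)"
      have "F c (s c) = (x - y) / (x + y)"
        unfolding F_def x_def y_def by (simp add: ti[OF c])
      moreover have "(\<epsilon> - t c) * D_plus fp fm (c, t c) = x / (2 * t c)"
          "(\<epsilon> + t c) * D_minus fp fm (c, t c) = y / (2 * t c)"
        unfolding x_def y_def D_plus_h D_minus_g by (simp_all add: ti[OF c])
      moreover have "0 < x" "0 < y"
        unfolding x_def y_def using S[OF c] tpos[OF c] e0 by auto
      ultimately show ?thesis
        using tpos[OF c] by (simp add: diff_divide_distrib[symmetric] add_divide_distrib[symmetric])
          (simp add: field_simps)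
    qed
    ultimately show "(t has_real_derivative ((\<epsilon> + t c) * D_minus fp fm (c, t c) - (\<epsilon> - t c) * D_plus fp fm (c, t c))
            / ((\<epsilon> + t c) * D_minus fp fm (c, t c) + (\<epsilon> - t c) * D_plus fp fm (c, t c))) (at c)"
      by simp
  qed
  then show ?thesis by (intro exI[of _ t])
qed

end

context double_root_of_D_minus
begin

text \<open>
  Away from the box, strict positivity at the width \<open>\<epsilon>0\<close> persists for nearby widths by compactness.
\<close>
lemma past_double_root_eventually:
  obtains \<delta> \<epsilon>p where "\<epsilon>0 < \<epsilon>p"
    and "\<And>\<epsilon>. \<lbrakk>\<epsilon>0 < \<epsilon>; \<epsilon> < \<epsilon>p\<rbrakk> \<Longrightarrow> past_double_root fp fm u1 u0 u2 \<epsilon>0 \<delta> \<epsilon>"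
proof -
  obtain \<delta> where box: "box_at \<delta>" using box_exists ..
  then have \<delta>: "0 < \<delta>" by (simp add: box_at_def)
  define K where "K = {u1..u2} - {u0 - \<delta><..<u0 + \<delta>}"
  have "compact K" unfolding K_def by (intro compact_diff) auto
  then obtain r1 where r1: "0 < r1" "\<And>c t. \<lbrakk>c \<in> K; \<bar>t - \<epsilon>0\<bar> < r1\<rbrakk> \<Longrightarrow> 0 < g c t"
    using pos_on_compact_nearby[OF continuous_joint(1), of K \<epsilon>0] g_pos \<delta> by (force simp: K_def)
  obtain r2 where r2: "0 < r2" "\<And>c t. \<lbrakk>c \<in> {u1..u2}; \<bar>t - \<epsilon>0\<bar> < r2\<rbrakk> \<Longrightarrow> 0 < h c t"
    using pos_on_compact_nearby[OF continuous_joint(2), of "{u1..u2}" \<epsilon>0] h_pos by force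
  define \<epsilon>p where "\<epsilon>p = \<epsilon>0 + min (\<delta> / 5) (min r1 r2)"
  show ?thesis
  proof (rule that[of \<epsilon>p \<delta>])
    show "\<epsilon>0 < \<epsilon>p" using \<delta> r1 r2 by (simp add: \<epsilon>p_def)
    fix \<epsilon> assume e: "\<epsilon>0 < \<epsilon>" "\<epsilon> < \<epsilon>p"
    then have "\<epsilon> - \<epsilon>0 < \<delta> / 5" "\<bar>\<epsilon> - \<epsilon>0\<bar> < r1" "\<bar>\<epsilon> - \<epsilon>0\<bar> < r2" by (auto simp: \<epsilon>p_def)
    then show "past_double_root fp fm u1 u0 u2 \<epsilon>0 \<delta> \<epsilon>"
      using box e r1(2)[of _ \<epsilon>] r2(2)[of _ \<epsilon>]
      by unfold_locales (auto simp: K_def abs_le_iff abs_if split: if_splits)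
  qed
qed

end

section \<open>Existence of the foliation\<close>

theorem theorem8p2:
  fixes fp fm :: "real \<Rightarrow> real"
    and u1 u0 u2 \<epsilon>m \<epsilon>0 :: real
  assumes "class_C 4 fp" and "class_C 4 fm"
    and "u1 < u0" and "u0 < u2"
    and "0 \<le> \<epsilon>m" and "\<epsilon>m < \<epsilon>0"
    and "\<forall>u\<in>{u1..u2}. \<forall>\<epsilon>\<in>{\<epsilon>m<..<\<epsilon>0}. D_plus fp fm (u, \<epsilon>) > 0 \<and> D_minus fp fm (u, \<epsilon>) > 0"
    and "root_of_order 1 (\<lambda>\<epsilon>. D_minus fp fm (u0, \<epsilon>)) \<epsilon>0"
    and "\<forall>u\<in>{u1..u2} - {u0}. D_minus fp fm (u, \<epsilon>0) > 0"
    and "\<forall>u\<in>{u1..u2}. D_plus fp fm (u, \<epsilon>0) > 0"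
    and "root_of_order 2 (\<lambda>u. D_minus fp fm (u, \<epsilon>0)) u0"
  shows "\<exists>\<epsilon>p>\<epsilon>0. \<forall>\<epsilon>\<in>{\<epsilon>0<..<\<epsilon>p}.
    \<exists>ul ur. u1 < ul \<and> ul < ur \<and> ur < u2 \<and>
      D_minus fp fm (ul, \<epsilon>) = 0 \<and> D_minus fp fm (ur, \<epsilon>) = 0 \<and>
      (\<exists>B T.
        C1_smooth_on (Omega_R \<epsilon> u1 u2) B \<and>
        diagonally_concave_on (Omega_R \<epsilon> u1 u2) B \<and>
        boundary_values fp fm \<epsilon> (Omega_R \<epsilon> u1 u2) B \<and>
        right_simple_candidate fp fm \<epsilon> u1 ul B \<and>
        right_simple_candidate fp fm \<epsilon> ur u2 B \<and>
        right_herringbone_candidate fp fm \<epsilon> (ul - \<epsilon>) (ur - \<epsilon>) T B \<and>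
        herringbone_domain \<epsilon> (ul - \<epsilon>) (ur - \<epsilon>) T = Omega_E_minus \<epsilon> ul ur \<and>
        T (ul - \<epsilon>) = -\<epsilon> \<and> T (ur - \<epsilon>) = -\<epsilon> \<and>
        (\<forall>u\<in>{ul - \<epsilon>..ur - \<epsilon>}. T u \<noteq> 0))"
proof -
  interpret double_root_of_D_minus fp fm u1 u0 u2 \<epsilon>0
    using assms by unfold_locales auto
  obtain \<delta> \<epsilon>p where "\<epsilon>0 < \<epsilon>p"
    and past: "\<And>\<epsilon>. \<lbrakk>\<epsilon>0 < \<epsilon>; \<epsilon> < \<epsilon>p\<rbrakk> \<Longrightarrow> past_double_root fp fm u1 u0 u2 \<epsilon>0 \<delta> \<epsilon>"
    using past_double_root_eventually by metis
  show ?thesis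
  proof (rule exI[of _ \<epsilon>p], rule conjI[OF \<open>\<epsilon>0 < \<epsilon>p\<close>], rule ballI)
    fix \<epsilon> assume e: "\<epsilon> \<in> {\<epsilon>0<..<\<epsilon>p}"
    interpret past_double_root fp fm u1 u0 u2 \<epsilon>0 \<delta> \<epsilon>
      by (rule past) (use e in auto)
    obtain t where "spine_parametrization fp fm t \<epsilon> ul ur u1 u2"
      using spine_parametrization_exists by (elim exE)
    note candidate = spine_parametrization.candidate_exists[OF this]
    show "\<exists>ul ur. u1 < ul \<and> ul < ur \<and> ur < u2 \<and>
      D_minus fp fm (ul, \<epsilon>) = 0 \<and> D_minus fp fm (ur, \<epsilon>) = 0 \<and>
      (\<exists>B T.
        C1_smooth_on (Omega_R \<epsilon> u1 u2) B \<and>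
        diagonally_concave_on (Omega_R \<epsilon> u1 u2) B \<and>
        boundary_values fp fm \<epsilon> (Omega_R \<epsilon> u1 u2) B \<and>
        right_simple_candidate fp fm \<epsilon> u1 ul B \<and>
        right_simple_candidate fp fm \<epsilon> ur u2 B \<and>
        right_herringbone_candidate fp fm \<epsilon> (ul - \<epsilon>) (ur - \<epsilon>) T B \<and>
        herringbone_domain \<epsilon> (ul - \<epsilon>) (ur - \<epsilon>) T = Omega_E_minus \<epsilon> ul ur \<and>
        T (ul - \<epsilon>) = -\<epsilon> \<and> T (ur - \<epsilon>) = -\<epsilon> \<and>
        (\<forall>u\<in>{ul - \<epsilon>..ur - \<epsilon>}. T u \<noteq> 0))"
      by (rule exI[of _ ul], rule exI[of _ ur], intro conjI candidate)
         (use ul ur \<delta> in \<open>simp_all add: D_minus_g\<close>)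
  qed
qed

end
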